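(* If $\lambda X$ is a supersorted pure type system, then $\lambda X$ and $\lambda X^{h+}$ have the same valid judgements: for every context $\Gamma$ and pseudoterms $M,A$, $\Gamma\vdash M:A$ is derivable in $\lambda X$ if and only if it is derivable in $\lambda X^{h+}$.
   Context: Pure type systems (PTS). A PTS $\lambda X$ has variables, constants $\mathcal C$, sorts $\mathcal S\subseteq\mathcal C$, axioms $\mathcal A$ ($c:s$), rules $\mathcal R\subseteq\mathcal S^3$; pseudoterms $\mathcal T::=V\mid\mathcal C\mid\Pi V{:}\mathcal T.\mathcal T\mid\lambda V{:}\mathcal T.\mathcal T\mid\mathcal T\mathcal T$; derivable judgements $\Gamma\vdash M:A$ generated by (axiom) $\vdash c:s$ for $(c:s)\in\mathcal A$; (start) $\Gamma\vdash A:s\Rightarrow\Gamma,x:A\vdash x:A$ ($x$ fresh); (weakening) $\Gamma\vdash M:B$, $\Gamma\vdash A:s\Rightarrow\Gamma,x:A\vdash M:B$ ($x$ fresh); (application) $\Gamma\vdash M:\Pi x{:}A.B$, $\Gamma\vdash N:A\Rightarrow\Gamma\vdash MN:B[x:=N]$; (abstraction) $\Gamma,x:A\vdash M:B$, $\Gamma\vdash(\Pi x{:}A.B):s\Rightarrow\Gamma\vdash(\lambda x{:}A.M):(\Pi x{:}A.B)$; (product) $\Gamma,x:A\vdash B:s_2$, $\Gamma\vdash A:s_1$, $(s_1,s_2,s_3)\in\mathcal R\Rightarrow\Gamma\vdash(\Pi x{:}A.B):s_3$; (conversion) $\Gamma\vdash M:A$, $\Gamma\vdash B:s$, $A=_\beta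 B\Rightarrow\Gamma\vdash M:B$. Supersorted: every $c\in\mathcal C$ has some $s$ with $(c:s)\in\mathcal A$, and for all $s_1,s_2\in\mathcal S$ there is $s_3$ with $(s_1,s_2,s_3)\in\mathcal R$. Corresponding HPTS $\lambda X^h$: only empty contexts; derivable judgements generated by the axioms of $\mathcal A$ and of a set $\mathcal B$ (below), (application) and (conversion), (type reduction) $\vdash M:A$, $A\to_\beta B\Rightarrow\vdash M:B$, (subject reduction) $\vdash M:A$, $M\to_\beta N\Rightarrow\vdash N:A$. $\mathcal B$ consists of the following schemes, each standing for all its instances (sorts substituted for sort variables) derivable in $\lambda X$: (Π1) $\vdash[\lambda u{:}s_1.\lambda v{:}(\Pi x{:}u.s_2).\Pi x{:}u.vx]:[\Pi u{:}s_1.\Pi v{:}(\Pi x{:}u.s_2).s_3]$ for $(s_1,s_2,s_3)\in\mathcal R$; (I1) $\vdash[\lambda x{:}s_1.\lambda y{:}x.y]:[\Pi x{:}s_1.\Pi y{:}x.x]$; (K1) $\vdash[\lambda x{:}s_1.\lambda y{:}s_2.\lambda z{:}x.\lambda u{:}y.z]:[\Pi x{:}s_1.\Pi y{:}s_2.\Pi z{:}x.\Pi u{:}y.x]$; (S1) $\vdash[\lambda u{:}s_1.\lambda v{:}(\Pi x{:}u.s_2).\lambda t{:}(\Pi x{:}u.\Pi y{:}vx.s_3).\lambda w{:}(\Pi x{:}u.\Pi y{:}vx.txy).\lambda z{:}(\Pi x{:}u.vx).\lambda x{:}u.wx(zx)]:[\Pi u{:}s_1.\Pi v{:}(\Pi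 x{:}u.s_2).\Pi t{:}(\Pi x{:}u.\Pi y{:}vx.s_3).\Pi w{:}(\Pi x{:}u.\Pi y{:}vx.txy).\Pi z{:}(\Pi x{:}u.vx).\Pi x{:}u.tx(zx)]$; plus those generated by the closure rules: (I) if $(M:A)\in\mathcal B$, $A\notin\mathcal S$, and $A'$ arises from $A$ by replacing zero or more repeated occurrences of a sort variable $s_i$ by a sort variable $s_j$ not in $A$, then $(A':s)\in\mathcal B$ for each $s\in\mathcal S$ with $\vdash A':s$ derivable in $\lambda X$; (II) if $([\lambda x_1{:}A_1\ldots\lambda x_{i-1}{:}A_{i-1}.\Pi x_i{:}A_i.B]:[\Pi x_1{:}A_1\ldots\Pi x_{i-1}{:}A_{i-1}.s])\in\mathcal B$ and $s'\in\mathcal S$ is such that $\vdash(\lambda x_1{:}A_1\ldots\lambda x_i{:}A_i.B):(\Pi x_1{:}A_1\ldots\Pi x_i{:}A_i.s')$ is derivable in $\lambda X$, then this judgement is in $\mathcal B$. $\lambda X^{h+}$: the system whose derivable judgements $\Gamma\vdash M:A$ (arbitrary contexts) are generated by the axioms of $\mathcal A\cup\mathcal B$ (with empty context), the rules (application), (conversion), (type reduction) and (subject reduction) of $\lambda X^h$ now with an arbitrary context $\Gamma$ in premises and conclusion, and the (start) and (weakening) rules of $\lambda X$. *)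

theory Defs
  imports Main
begin

section \<open>Pseudoterms\<close>

text \<open>Pseudoterms modulo renaming of bound variables, in de Bruijn notation. The type \<open>'c\<close> is
  the set of constants; \<open>Prd A B\<close> and \<open>Abs A M\<close> bind index 0 in \<open>B\<close> and \<open>M\<close>, respectively.\<close>

datatype 'c trm =
    Var nat
  | Cst 'c
  | Prd "'c trm" "'c trm"
  | Abs "'c trm" "'c trm"
  | App "'c trm" "'c trm"

primrec lift :: "'c trm \<Rightarrow> nat \<Rightarrow> 'c trm" where
  "lift (Var i) k = (if i < k then Var i else Var (Suc i))"
| "lift (Cst c) k = Cst c"
| "lift (Prd A B) k = Prd (lift A k) (lift B (Suc k))"
| "lift (Abs A M) k = Abs (lift A k) (lift M (Suc k))"
| "lift (App M N) k = App (lift M k) (lift N k)"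

text \<open>\<open>subst M N k\<close> substitutes \<open>N\<close> for index \<open>k\<close> in \<open>M\<close> and removes \<open>k\<close> from the scope.\<close>

primrec subst :: "'c trm \<Rightarrow> 'c trm \<Rightarrow> nat \<Rightarrow> 'c trm" where
  "subst (Var i) N k = (if k < i then Var (i - 1) else if i = k then N else Var i)"
| "subst (Cst c) N k = Cst c"
| "subst (Prd A B) N k = Prd (subst A N k) (subst B (lift N 0) (Suc k))"
| "subst (Abs A M) N k = Abs (subst A N k) (subst M (lift N 0) (Suc k))"
| "subst (App M M') N k = App (subst M N k) (subst M' N k)"

inductive beta :: "'c trm \<Rightarrow> 'c trm \<Rightarrow> bool" (infix \<open>\<rightarrow>\<^sub>\<beta>\<close> 50) where
  redex: "App (Abs A M) N \<rightarrow>\<^sub>\<beta> subst M N 0"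
| PrdL: "A \<rightarrow>\<^sub>\<beta> A' \<Longrightarrow> Prd A B \<rightarrow>\<^sub>\<beta> Prd A' B"
| PrdR: "B \<rightarrow>\<^sub>\<beta> B' \<Longrightarrow> Prd A B \<rightarrow>\<^sub>\<beta> Prd A B'"
| AbsL: "A \<rightarrow>\<^sub>\<beta> A' \<Longrightarrow> Abs A M \<rightarrow>\<^sub>\<beta> Abs A' M"
| AbsR: "M \<rightarrow>\<^sub>\<beta> M' \<Longrightarrow> Abs A M \<rightarrow>\<^sub>\<beta> Abs A M'"
| AppL: "M \<rightarrow>\<^sub>\<beta> M' \<Longrightarrow> App M N \<rightarrow>\<^sub>\<beta> App M' N"
| AppR: "N \<rightarrow>\<^sub>\<beta> N' \<Longrightarrow> App M N \<rightarrow>\<^sub>\<beta> App M N'"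

abbreviation beta_eq :: "'c trm \<Rightarrow> 'c trm \<Rightarrow> bool" (infix \<open>=\<^sub>\<beta>\<close> 50) where
  "A =\<^sub>\<beta> B \<equiv> equivclp beta A B"


section \<open>Pure type systems\<close>

record 'c pts =
  sorts :: "'c set"
  axioms :: "('c \<times> 'c) set"
  rules :: "('c \<times> 'c \<times> 'c) set"

definition is_pts :: "'c pts \<Rightarrow> bool" where
  "is_pts X \<longleftrightarrow> axioms X \<subseteq> UNIV \<times> sorts X \<and> rules X \<subseteq> sorts X \<times> sorts X \<times> sorts X"

definition supersorted :: "'c pts \<Rightarrow> bool" where
  "supersorted X \<longleftrightarrow>
     (\<forall>c. \<exists>s. (c, s) \<in> axioms X) \<and>
     (\<forall>s\<^sub>1\<in>sorts X. \<forall>s\<^sub>2\<in>sorts X. \<exists>s\<^sub>3. (s\<^sub>1, s\<^sub>2, s\<^sub>3) \<in> rules X)"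

text \<open>A context is the list of its types, most recent declaration first, each type living in the
  context formed by the rest of the list. Freshness of the declared variable is built in.\<close>

type_synonym 'c ctxt = "'c trm list"

inductive derivable :: "'c pts \<Rightarrow> 'c ctxt \<Rightarrow> 'c trm \<Rightarrow> 'c trm \<Rightarrow> bool" for X where
  axiom: "(c, s) \<in> axioms X \<Longrightarrow> derivable X [] (Cst c) (Cst s)"
| start: "derivable X \<Gamma> A (Cst s) \<Longrightarrow> s \<in> sorts X \<Longrightarrow> derivable X (A # \<Gamma>) (Var 0) (lift A 0)"
| weakening: "derivable X \<Gamma> M B \<Longrightarrow> derivable X \<Gamma> A (Cst s) \<Longrightarrow> s \<in> sorts X \<Longrightarrow>
    derivable X (A # \<Gamma>) (lift M 0) (lift B 0)"
| application: "derivable X \<Gamma> M (Prd A B) \<Longrightarrow> derivable X \<Gamma> N A \<Longrightarrow>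
    derivable X \<Gamma> (App M N) (subst B N 0)"
| abstraction: "derivable X (A # \<Gamma>) M B \<Longrightarrow> derivable X \<Gamma> (Prd A B) (Cst s) \<Longrightarrow> s \<in> sorts X \<Longrightarrow>
    derivable X \<Gamma> (Abs A M) (Prd A B)"
| product: "derivable X (A # \<Gamma>) B (Cst s\<^sub>2) \<Longrightarrow> derivable X \<Gamma> A (Cst s\<^sub>1) \<Longrightarrow>
    (s\<^sub>1, s\<^sub>2, s\<^sub>3) \<in> rules X \<Longrightarrow> derivable X \<Gamma> (Prd A B) (Cst s\<^sub>3)"
| conversion: "derivable X \<Gamma> M A \<Longrightarrow> derivable X \<Gamma> B (Cst s) \<Longrightarrow> s \<in> sorts X \<Longrightarrow> A =\<^sub>\<beta> B \<Longrightarrow>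
    derivable X \<Gamma> M B"


section \<open>The axiom schemes of the Hilbert-style system\<close>

text \<open>A scheme is a judgement over \<^typ>\<open>nat trm\<close>, whose constants are the sort variables
  \<open>s\<^sub>i = Cst i\<close>. Its instances are obtained by mapping all sort variables to sorts. No concrete
  sorts are needed in schemes, since each of them is an instance of a sort variable.\<close>

definition sort_valuation :: "'c pts \<Rightarrow> (nat \<Rightarrow> 'c) \<Rightarrow> bool" where
  "sort_valuation X \<sigma> \<longleftrightarrow> (\<forall>i. \<sigma> i \<in> sorts X)"

definition derivable_instance :: "'c pts \<Rightarrow> (nat \<Rightarrow> 'c) \<Rightarrow> nat trm \<Rightarrow> nat trm \<Rightarrow> bool" where
  "derivable_instance X \<sigma> M A \<longleftrightarrow>
     sort_valuation X \<sigma> \<and> derivable X [] (map_trm \<sigma> M) (map_trm \<sigma> A)"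

text \<open>Telescopes \<open>\<lambda>x\<^sub>1:A\<^sub>1 \<dots> \<lambda>x\<^sub>n:A\<^sub>n. M\<close> and \<open>\<Pi>x\<^sub>1:A\<^sub>1 \<dots> \<Pi>x\<^sub>n:A\<^sub>n. B\<close>, outermost binder first.\<close>

abbreviation Abss :: "'c trm list \<Rightarrow> 'c trm \<Rightarrow> 'c trm" where
  "Abss \<Delta> M \<equiv> foldr Abs \<Delta> M"

abbreviation Prds :: "'c trm list \<Rightarrow> 'c trm \<Rightarrow> 'c trm" where
  "Prds \<Delta> B \<equiv> foldr Prd \<Delta> B"

text \<open>\<open>[\<lambda>u:s\<^sub>1. \<lambda>v:(\<Pi>x:u. s\<^sub>2). \<Pi>x:u. v x] : [\<Pi>u:s\<^sub>1. \<Pi>v:(\<Pi>x:u. s\<^sub>2). s\<^sub>3]\<close>\<close>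

definition Pi1_tele :: "nat trm list" where
  "Pi1_tele = [Cst 1, Prd (Var 0) (Cst 2)]"

definition Pi1_tm :: "nat trm" where
  "Pi1_tm = Abss Pi1_tele (Prd (Var 1) (App (Var 1) (Var 0)))"

definition Pi1_ty :: "nat trm" where
  "Pi1_ty = Prds Pi1_tele (Cst 3)"

text \<open>\<open>[\<lambda>x:s\<^sub>1. \<lambda>y:x. y] : [\<Pi>x:s\<^sub>1. \<Pi>y:x. x]\<close>\<close>

definition I1_tele :: "nat trm list" where
  "I1_tele = [Cst 1, Var 0]"

definition I1_tm :: "nat trm" where
  "I1_tm = Abss I1_tele (Var 0)"

definition I1_ty :: "nat trm" where
  "I1_ty = Prds I1_tele (Var 1)"

text \<open>\<open>[\<lambda>x:s\<^sub>1. \<lambda>y:s\<^sub>2. \<lambda>z:x. \<lambda>u:y. z] : [\<Pi>x:s\<^sub>1. \<Pi>y:s\<^sub>2. \<Pi>z:x. \<Pi>u:y. x]\<close>\<close>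

definition K1_tele :: "nat trm list" where
  "K1_tele = [Cst 1, Cst 2, Var 1, Var 1]"

definition K1_tm :: "nat trm" where
  "K1_tm = Abss K1_tele (Var 1)"

definition K1_ty :: "nat trm" where
  "K1_ty = Prds K1_tele (Var 3)"

text \<open>The binders of the next telescope are \<open>u:s\<^sub>1\<close>, \<open>v:(\<Pi>x:u. s\<^sub>2)\<close>, \<open>t:(\<Pi>x:u. \<Pi>y:v x. s\<^sub>3)\<close>,
  \<open>w:(\<Pi>x:u. \<Pi>y:v x. t x y)\<close>, \<open>z:(\<Pi>x:u. v x)\<close>, \<open>x:u\<close>; the bodies are \<open>w x (z x)\<close> and
  \<open>t x (z x)\<close>.\<close>

definition S1_tele :: "nat trm list" where
  "S1_tele =
    [Cst 1,
     Prd (Var 0) (Cst 2),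
     Prd (Var 1) (Prd (App (Var 1) (Var 0)) (Cst 3)),
     Prd (Var 2) (Prd (App (Var 2) (Var 0)) (App (App (Var 2) (Var 1)) (Var 0))),
     Prd (Var 3) (App (Var 3) (Var 0)),
     Var 4]"

definition S1_tm :: "nat trm" where
  "S1_tm = Abss S1_tele (App (App (Var 2) (Var 0)) (App (Var 1) (Var 0)))"

definition S1_ty :: "nat trm" where
  "S1_ty = Prds S1_tele (App (App (Var 3) (Var 0)) (App (Var 1) (Var 0)))"

primrec occs :: "'c \<Rightarrow> 'c trm \<Rightarrow> nat" where
  "occs c (Var i) = 0"
| "occs c (Cst d) = (if d = c then 1 else 0)"
| "occs c (Prd A B) = occs c A + occs c B"
| "occs c (Abs A M) = occs c A + occs c M"
| "occs c (App M N) = occs c M + occs c N"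

text \<open>\<open>A'\<close> arises from \<open>A\<close> by replacing zero or more of the repeated occurrences of some sort
  variable \<open>s\<^sub>i\<close> by a sort variable \<open>s\<^sub>j\<close> not in \<open>A\<close>. The relator \<^const>\<open>rel_trm\<close> decides about
  each occurrence of \<open>s\<^sub>i\<close> separately.\<close>

definition replaces_repeated :: "nat trm \<Rightarrow> nat trm \<Rightarrow> bool" where
  "replaces_repeated A A' \<longleftrightarrow>
     A' = A \<or>
     (\<exists>i j. 2 \<le> occs i A \<and> j \<notin> set_trm A \<and> rel_trm (\<lambda>a b. b = a \<or> a = i \<and> b = j) A A')"

text \<open>In the two closure rules the sort of the new scheme is again a sort variable \<open>s\<^sub>j\<close>, old or
  new. A scheme is added as soon as some instance of it is derivable in the pure type system; it
  then stands for exactly its derivable instances.\<close>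

inductive scheme :: "'c pts \<Rightarrow> nat trm \<Rightarrow> nat trm \<Rightarrow> bool" for X where
  Pi1: "scheme X Pi1_tm Pi1_ty"
| I1: "scheme X I1_tm I1_ty"
| K1: "scheme X K1_tm K1_ty"
| S1: "scheme X S1_tm S1_ty"
| closure_I: "scheme X M A \<Longrightarrow> \<forall>i. A \<noteq> Cst i \<Longrightarrow> replaces_repeated A A' \<Longrightarrow>
    \<exists>\<sigma>. derivable_instance X \<sigma> A' (Cst j) \<Longrightarrow> scheme X A' (Cst j)"
| closure_II: "scheme X (Abss \<Delta> (Prd A B)) (Prds \<Delta> (Cst i)) \<Longrightarrow>
    \<exists>\<sigma>. derivable_instance X \<sigma> (Abss (\<Delta> @ [A]) B) (Prds (\<Delta> @ [A]) (Cst j)) \<Longrightarrow>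
    scheme X (Abss (\<Delta> @ [A]) B) (Prds (\<Delta> @ [A]) (Cst j))"

text \<open>The judgements that the schemes stand for; the last conjunct is the side condition of the
  scheme for products.\<close>

definition hilbert_axiom :: "'c pts \<Rightarrow> 'c trm \<Rightarrow> 'c trm \<Rightarrow> bool" where
  "hilbert_axiom X M A \<longleftrightarrow>
     (\<exists>\<sigma> M\<^sub>0 A\<^sub>0. scheme X M\<^sub>0 A\<^sub>0 \<and> M = map_trm \<sigma> M\<^sub>0 \<and> A = map_trm \<sigma> A\<^sub>0 \<and>
        derivable_instance X \<sigma> M\<^sub>0 A\<^sub>0 \<and>
        (M\<^sub>0 = Pi1_tm \<and> A\<^sub>0 = Pi1_ty \<longrightarrow> (\<sigma> 1, \<sigma> 2, \<sigma> 3) \<in> rules X))"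


section \<open>The Hilbert-style system with contexts\<close>

inductive derivable_hplus :: "'c pts \<Rightarrow> 'c ctxt \<Rightarrow> 'c trm \<Rightarrow> 'c trm \<Rightarrow> bool" for X where
  axiom: "(c, s) \<in> axioms X \<Longrightarrow> derivable_hplus X [] (Cst c) (Cst s)"
| hilbert: "hilbert_axiom X M A \<Longrightarrow> derivable_hplus X [] M A"
| start: "derivable_hplus X \<Gamma> A (Cst s) \<Longrightarrow> s \<in> sorts X \<Longrightarrow>
    derivable_hplus X (A # \<Gamma>) (Var 0) (lift A 0)"
| weakening: "derivable_hplus X \<Gamma> M B \<Longrightarrow> derivable_hplus X \<Gamma> A (Cst s) \<Longrightarrow> s \<in> sorts X \<Longrightarrow>
    derivable_hplus X (A # \<Gamma>) (lift M 0) (lift B 0)"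
| application: "derivable_hplus X \<Gamma> M (Prd A B) \<Longrightarrow> derivable_hplus X \<Gamma> N A \<Longrightarrow>
    derivable_hplus X \<Gamma> (App M N) (subst B N 0)"
| conversion: "derivable_hplus X \<Gamma> M A \<Longrightarrow> derivable_hplus X \<Gamma> B (Cst s) \<Longrightarrow> s \<in> sorts X \<Longrightarrow>
    A =\<^sub>\<beta> B \<Longrightarrow> derivable_hplus X \<Gamma> M B"
| type_reduction: "derivable_hplus X \<Gamma> M A \<Longrightarrow> A \<rightarrow>\<^sub>\<beta> B \<Longrightarrow> derivable_hplus X \<Gamma> M B"
| subject_reduction: "derivable_hplus X \<Gamma> M A \<Longrightarrow> M \<rightarrow>\<^sub>\<beta> N \<Longrightarrow> derivable_hplus X \<Gamma> N A"

end

theory Submission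
  imports Defs "HOL-Library.Confluence"
begin

text \<open>Every rule of \<open>\<lambda>X\<^sup>h\<^sup>+\<close> is admissible in \<open>\<lambda>X\<close> by subject reduction and correctness of types.
  Conversely, the abstraction rule is admissible in \<open>\<lambda>X\<^sup>h\<^sup>+\<close> by bracket abstraction: induction on a
  derivation of \<open>\<Gamma>, x:A \<turnstile> M : B\<close> yields \<open>\<Gamma> \<turnstile> (\<lambda>x:A. M) : (\<Pi>x:A. B)\<close>, where start, weakening and
  application are handled by \<open>I1\<close>, \<open>K1\<close> and \<open>S1\<close> followed by subject reduction; the product rule then
  follows with \<open>\<Pi>1\<close>. To apply \<open>S1\<close> to abstractions of \<open>M : \<Pi>y:C. D\<close> and \<open>N : C\<close> one needs
  \<open>\<lambda>x:A. C\<close> and \<open>\<lambda>x:A. \<lambda>y:C. D\<close> to be typed as well. Therefore the induction is carried out for a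
  variant of \<open>\<lambda>X\<^sup>h\<^sup>+\<close> in which \<open>C\<close>, \<open>\<Pi>y:C. D\<close> and \<open>\<lambda>y:C. D\<close> are typed by premises of the application
  rule. For the applications of the combinators themselves these premises are supplied by the closure
  rules (I) and (II).\<close>

section \<open>Lifting and substitution\<close>

lemma lift_lift: "i \<le> k \<Longrightarrow> lift (lift t i) (Suc k) = lift (lift t k) i"
  by (induct t arbitrary: i k) auto

lemma lift_subst: "j \<le> i \<Longrightarrow> lift (subst t s j) i = subst (lift t (Suc i)) (lift s i) j"
  by (induct t arbitrary: i j s) (simp_all add: diff_Suc lift_lift split: nat.split)

lemma lift_subst_lt: "i \<le> j \<Longrightarrow> lift (subst t s j) i = subst (lift t i) (lift s i) (Suc j)"
  by (induct t arbitrary: i j s) (auto simp: lift_lift)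

lemma subst_lift [simp]: "subst (lift t k) s k = t"
  by (induct t arbitrary: k s) simp_all

lemma subst_subst:
  "i \<le> j \<Longrightarrow> subst (subst t (lift v i) (Suc j)) (subst u v j) i = subst (subst t u i) v j"
  by (induct t arbitrary: i j u v)
    (simp_all add: diff_Suc lift_lift [symmetric] lift_subst_lt split: nat.split)

text \<open>Under a binder, a lifted abstraction applied to the bound variable contracts to its own
  body. This removes the redexes that \<open>S1\<close> and \<open>Pi1\<close> leave behind.\<close>

lemma subst_lift_Var [simp]: "subst (lift t (Suc k)) (Var k) k = t"
  by (induct t arbitrary: k) auto

lemma subst_lift_lift_Var [simp]: "subst (lift (lift t (Suc k)) (Suc k)) (Var (Suc k)) k = lift t k"
  by (induct t arbitrary: k) auto

lemma lift_eq_Prd: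
  "lift t k = Prd A B \<Longrightarrow> \<exists>A' B'. t = Prd A' B' \<and> A = lift A' k \<and> B = lift B' (Suc k)"
  by (cases t) (auto split: if_splits)

lemma lift_eq_Abs:
  "lift t k = Abs A B \<Longrightarrow> \<exists>A' B'. t = Abs A' B' \<and> A = lift A' k \<and> B = lift B' (Suc k)"
  by (cases t) (auto split: if_splits)

lemma lift_eq_App:
  "lift t k = App A B \<Longrightarrow> \<exists>A' B'. t = App A' B' \<and> A = lift A' k \<and> B = lift B' k"
  by (cases t) (auto split: if_splits)


section \<open>Reduction and conversion\<close>

lemma rtranclp_map:
  assumes "\<And>x y. r x y \<Longrightarrow> r' (f x) (f y)" and "r\<^sup>*\<^sup>* x y"
  shows "r'\<^sup>*\<^sup>* (f x) (f y)"
  using assms(2) by induct (auto intro: rtranclp.rtrancl_into_rtrancl assms(1))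

lemma equivclp_map:
  assumes "\<And>x y. r x y \<Longrightarrow> r' (f x) (f y)" and "equivclp r x y"
  shows "equivclp r' (f x) (f y)"
  using assms(2) by induct (auto intro: equivclp_into_equivclp assms(1))

abbreviation betas :: "'c trm \<Rightarrow> 'c trm \<Rightarrow> bool" (infix \<open>\<rightarrow>\<^sub>\<beta>\<^sup>*\<close> 50) where
  "A \<rightarrow>\<^sub>\<beta>\<^sup>* B \<equiv> beta\<^sup>*\<^sup>* A B"

lemma betas_Prd: "A \<rightarrow>\<^sub>\<beta>\<^sup>* A' \<Longrightarrow> B \<rightarrow>\<^sub>\<beta>\<^sup>* B' \<Longrightarrow> Prd A B \<rightarrow>\<^sub>\<beta>\<^sup>* Prd A' B'"
  by (rule rtranclp_trans[OF rtranclp_map[of _ _ "\<lambda>A. Prd A B"] rtranclp_map[of _ _ "Prd A'"]])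
    (auto intro: beta.intros)

lemma betas_Abs: "A \<rightarrow>\<^sub>\<beta>\<^sup>* A' \<Longrightarrow> M \<rightarrow>\<^sub>\<beta>\<^sup>* M' \<Longrightarrow> Abs A M \<rightarrow>\<^sub>\<beta>\<^sup>* Abs A' M'"
  by (rule rtranclp_trans[OF rtranclp_map[of _ _ "\<lambda>A. Abs A M"] rtranclp_map[of _ _ "Abs A'"]])
    (auto intro: beta.intros)

lemma betas_App: "M \<rightarrow>\<^sub>\<beta>\<^sup>* M' \<Longrightarrow> N \<rightarrow>\<^sub>\<beta>\<^sup>* N' \<Longrightarrow> App M N \<rightarrow>\<^sub>\<beta>\<^sup>* App M' N'"
  by (rule rtranclp_trans[OF rtranclp_map[of _ _ "\<lambda>M. App M N"] rtranclp_map[of _ _ "App M'"]])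
    (auto intro: beta.intros)

lemma betas_redex: "M \<rightarrow>\<^sub>\<beta>\<^sup>* Abs A P \<Longrightarrow> subst P N 0 = Q \<Longrightarrow> App M N \<rightarrow>\<^sub>\<beta>\<^sup>* Q"
  using betas_App[of M "Abs A P" N N] beta.redex[of A P N]
  by (auto intro: rtranclp.rtrancl_into_rtrancl)

lemma beta_lift: "M \<rightarrow>\<^sub>\<beta> N \<Longrightarrow> lift M k \<rightarrow>\<^sub>\<beta> lift N k"
  by (induct arbitrary: k set: beta) (auto simp: lift_subst intro: beta.intros)

lemma beta_subst: "M \<rightarrow>\<^sub>\<beta> N \<Longrightarrow> subst M P k \<rightarrow>\<^sub>\<beta> subst N P k"
  by (induct arbitrary: P k set: beta) (auto simp: subst_subst [symmetric] intro: beta.intros)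

text \<open>One step in \<open>N\<close> is repeated at every occurrence of the index
  \<open>k\<close>, hence the closure.\<close>

lemma betas_subst_arg: "N \<rightarrow>\<^sub>\<beta>\<^sup>* N' \<Longrightarrow> subst M N k \<rightarrow>\<^sub>\<beta>\<^sup>* subst M N' k"
proof (induct M arbitrary: N N' k)
  case (Prd A B)
  then have "lift N 0 \<rightarrow>\<^sub>\<beta>\<^sup>* lift N' 0"
    by (auto intro: rtranclp_map[of beta beta "\<lambda>t. lift t 0"] beta_lift)
  with Prd show ?case by (simp add: betas_Prd)
next
  case (Abs A B)
  then have "lift N 0 \<rightarrow>\<^sub>\<beta>\<^sup>* lift N' 0"
    by (auto intro: rtranclp_map[of beta beta "\<lambda>t. lift t 0"] beta_lift)
  with Abs show ?case by (simp add: betas_Abs)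
qed (auto intro: betas_App)

text \<open>Reduction creates no free variables, so a reduct of a lifted term still avoids the index
  \<open>k\<close>. The weakening case of subject reduction rests on this.\<close>

lemma beta_lift_inv: "lift M k \<rightarrow>\<^sub>\<beta> N \<Longrightarrow> \<exists>N'. N = lift N' k \<and> M \<rightarrow>\<^sub>\<beta> N'"
proof (induct "lift M k" N arbitrary: M k set: beta)
  case (redex A P N)
  then obtain A' P' N' where "M = App (Abs A' P') N'" "P = lift P' (Suc k)" "N = lift N' k"
    by (metis lift_eq_App lift_eq_Abs)
  then show ?case
    by (auto simp: lift_subst intro!: exI[of _ "subst P' N' 0"] beta.redex)
next
  case (PrdL A A' B)
  then show ?case by (metis lift_eq_Prd lift.simps(3) beta.PrdL)
next
  case (PrdR A A' B)
  then show ?case by (metis lift_eq_Prd lift.simps(3) beta.PrdR)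
next
  case (AbsL A A' B)
  then show ?case by (metis lift_eq_Abs lift.simps(4) beta.AbsL)
next
  case (AbsR A A' B)
  then show ?case by (metis lift_eq_Abs lift.simps(4) beta.AbsR)
next
  case (AppL A A' B)
  then show ?case by (metis lift_eq_App lift.simps(5) beta.AppL)
next
  case (AppR A A' B)
  then show ?case by (metis lift_eq_App lift.simps(5) beta.AppR)
qed

section \<open>Confluence of beta by parallel reduction\<close>

inductive par :: "'c trm \<Rightarrow> 'c trm \<Rightarrow> bool" where
  "par (Var i) (Var i)"
| "par (Cst c) (Cst c)"
| "par A A' \<Longrightarrow> par B B' \<Longrightarrow> par (Prd A B) (Prd A' B')"
| "par A A' \<Longrightarrow> par M M' \<Longrightarrow> par (Abs A M) (Abs A' M')"
| "par M M' \<Longrightarrow> par N N' \<Longrightarrow> par (App M N) (App M' N')"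
| "par M M' \<Longrightarrow> par N N' \<Longrightarrow> par (App (Abs A M) N) (subst M' N' 0)"

lemma par_refl: "par M M"
  by (induct M) (auto intro: par.intros)

lemma beta_imp_par: "M \<rightarrow>\<^sub>\<beta> N \<Longrightarrow> par M N"
  by (induct set: beta) (auto intro: par.intros par_refl)

lemma par_imp_betas: "par M N \<Longrightarrow> M \<rightarrow>\<^sub>\<beta>\<^sup>* N"
proof (induct set: par)
  case (6 M M' N N' A)
  then show ?case
    by (meson beta.redex betas_Abs betas_App rtranclp.rtrancl_into_rtrancl rtranclp.rtrancl_refl)
qed (auto intro: betas_Prd betas_Abs betas_App)

text \<open>Parallel reduction lies between one step and many steps of beta.\<close>

lemma rtranclp_par: "par\<^sup>*\<^sup>* = beta\<^sup>*\<^sup>*"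
proof (intro ext iffI)
  fix M N :: "'c trm"
  show "par\<^sup>*\<^sup>* M N \<Longrightarrow> M \<rightarrow>\<^sub>\<beta>\<^sup>* N"
    by (induct set: rtranclp) (auto dest: par_imp_betas)
  show "M \<rightarrow>\<^sub>\<beta>\<^sup>* N \<Longrightarrow> par\<^sup>*\<^sup>* M N"
    by (induct set: rtranclp) (auto dest: beta_imp_par)
qed

lemma par_lift: "par M N \<Longrightarrow> par (lift M k) (lift N k)"
  by (induct arbitrary: k set: par) (auto simp: lift_subst intro: par.intros)

lemma par_subst: "par M M' \<Longrightarrow> par N N' \<Longrightarrow> par (subst M N k) (subst M' N' k)"
proof (induct arbitrary: N N' k set: par)
  case (6 M M' P P' A)
  then show ?case
    by (auto simp: subst_subst [symmetric] intro!: par.intros(6) par_lift)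
qed (simp_all add: par.intros par_lift)

inductive_cases par_VarE: "par (Var i) N"
inductive_cases par_CstE: "par (Cst c) N"
inductive_cases par_PrdE: "par (Prd A B) N"
inductive_cases par_AbsE: "par (Abs A B) N"
inductive_cases par_AppE: "par (App A B) N"

text \<open>Takahashi's complete development, which contracts all redexes present in the term at
  once.\<close>

fun develop :: "'c trm \<Rightarrow> 'c trm" where
  "develop (App (Abs A M) N) = subst (develop M) (develop N) 0"
| "develop (App M N) = App (develop M) (develop N)"
| "develop (Prd A B) = Prd (develop A) (develop B)"
| "develop (Abs A M) = Abs (develop A) (develop M)"
| "develop (Var i) = Var i"
| "develop (Cst c) = Cst c"

text \<open>Triangle property: a parallel step contracts some of the present redexes, and one
  further parallel step contracts the residuals of the others. Any two parallel reducts of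
  \<open>M\<close> thus meet in \<open>develop M\<close>.\<close>

lemma par_develop: "par M N \<Longrightarrow> par N (develop M)"
proof (induct M arbitrary: N rule: develop.induct)
  case (1 A M P)
  from \<open>par (App (Abs A M) P) N\<close> show ?case
    using "1.hyps" by (auto elim!: par_AppE par_AbsE intro: par.intros par_subst)
qed (auto elim!: par_AppE par_PrdE par_AbsE par_VarE par_CstE intro: par.intros)

lemma confluentp_beta: "confluentp (beta :: 'c trm \<Rightarrow> _)"
proof -
  have "strong_confluentp (par :: 'c trm \<Rightarrow> _)"
    by (rule strong_confluentpI) (blast intro: par_develop)
  then have "confluentp (par :: 'c trm \<Rightarrow> _)"
    by (rule strong_confluentp_imp_confluentp)
  \<comment> \<open>Confluence speaks only of the reflexive transitive closure, which
    \<open>par\<close> shares with beta.\<close>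
  then show ?thesis
    by (simp add: confluentp_def rtranclp_conversep rtranclp_par)
qed

inductive_cases beta_VarE: "Var i \<rightarrow>\<^sub>\<beta> N"
inductive_cases beta_CstE: "Cst c \<rightarrow>\<^sub>\<beta> N"
inductive_cases beta_PrdE: "Prd A B \<rightarrow>\<^sub>\<beta> N"
inductive_cases beta_AbsE: "Abs A M \<rightarrow>\<^sub>\<beta> N"
inductive_cases beta_AppE: "App M P \<rightarrow>\<^sub>\<beta> N"

lemma betas_Prd_inv: "Prd A B \<rightarrow>\<^sub>\<beta>\<^sup>* N \<Longrightarrow> \<exists>A' B'. N = Prd A' B' \<and> A \<rightarrow>\<^sub>\<beta>\<^sup>* A' \<and> B \<rightarrow>\<^sub>\<beta>\<^sup>* B'"
proof (induct set: rtranclp)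
  case (step y z)
  then obtain A' B' where "Prd A' B' \<rightarrow>\<^sub>\<beta> z" "A \<rightarrow>\<^sub>\<beta>\<^sup>* A'" "B \<rightarrow>\<^sub>\<beta>\<^sup>* B'"
    by blast
  then show ?case
    by (elim beta_PrdE) (blast intro: rtranclp.rtrancl_into_rtrancl)+
qed simp

text \<open>By confluence the two products have a common reduct, and reduction never mixes the
  components of a product.\<close>

lemma beta_eq_Prd_inject:
  assumes "Prd A B =\<^sub>\<beta> Prd A' B'"
  shows "A =\<^sub>\<beta> A'" and "B =\<^sub>\<beta> B'"
proof -
  have "(beta\<^sup>*\<^sup>* OO beta\<inverse>\<inverse>\<^sup>*\<^sup>*) (Prd A B) (Prd A' B')"
    using assms
    unfolding semiconfluentp_equivclp[OF confluentp_imp_semiconfluentp[OF confluentp_beta]] .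
  then obtain C where "Prd A B \<rightarrow>\<^sub>\<beta>\<^sup>* C" "Prd A' B' \<rightarrow>\<^sub>\<beta>\<^sup>* C"
    by (auto simp: rtranclp_conversep)
  then obtain C1 C2 where "A \<rightarrow>\<^sub>\<beta>\<^sup>* C1" "A' \<rightarrow>\<^sub>\<beta>\<^sup>* C1" "B \<rightarrow>\<^sub>\<beta>\<^sup>* C2" "B' \<rightarrow>\<^sub>\<beta>\<^sup>* C2"
    by (blast dest: betas_Prd_inv)
  then show "A =\<^sub>\<beta> A'" and "B =\<^sub>\<beta> B'"
    by (meson equivclp_trans rtranclp_into_equivclp converse_rtranclp_into_equivclp)+
qed


section \<open>Metatheory of supersorted pure type systems\<close>

locale supersorted_pts =
  fixes X :: "'c pts"
  assumes is_pts: "is_pts X" and supersorted: "supersorted X"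
begin

lemma axiom_sort: "(c, s) \<in> axioms X \<Longrightarrow> s \<in> sorts X"
  using is_pts by (auto simp: is_pts_def)

lemma rule_sorts: "(s\<^sub>1, s\<^sub>2, s\<^sub>3) \<in> rules X \<Longrightarrow> s\<^sub>1 \<in> sorts X \<and> s\<^sub>2 \<in> sorts X \<and> s\<^sub>3 \<in> sorts X"
  using is_pts by (auto simp: is_pts_def)

lemma ex_axiom: "\<exists>s\<in>sorts X. (c, s) \<in> axioms X"
  using supersorted axiom_sort by (meson supersorted_def)

lemma ex_rule: "s\<^sub>1 \<in> sorts X \<Longrightarrow> s\<^sub>2 \<in> sorts X \<Longrightarrow> \<exists>s\<^sub>3\<in>sorts X. (s\<^sub>1, s\<^sub>2, s\<^sub>3) \<in> rules X"
  using supersorted rule_sorts by (meson supersorted_def)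

text \<open>The same judgements as \<^const>\<open>derivable\<close>, but the types occurring in an application are
  typed by subderivations, so that inductions can use them.\<close>

inductive judg :: "'c ctxt \<Rightarrow> 'c trm \<Rightarrow> 'c trm \<Rightarrow> bool" (\<open>_ \<turnstile> _ \<Colon> _\<close> [51, 51, 51] 50) where
  axiom: "(c, s) \<in> axioms X \<Longrightarrow> [] \<turnstile> Cst c \<Colon> Cst s"
| start: "\<Gamma> \<turnstile> A \<Colon> Cst s \<Longrightarrow> s \<in> sorts X \<Longrightarrow> A # \<Gamma> \<turnstile> Var 0 \<Colon> lift A 0"
| weakening: "\<Gamma> \<turnstile> M \<Colon> B \<Longrightarrow> \<Gamma> \<turnstile> A \<Colon> Cst s \<Longrightarrow> s \<in> sorts X \<Longrightarrow> A # \<Gamma> \<turnstile> lift M 0 \<Colon> lift B 0"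
| application: "\<Gamma> \<turnstile> M \<Colon> Prd A B \<Longrightarrow> \<Gamma> \<turnstile> N \<Colon> A \<Longrightarrow>
    \<Gamma> \<turnstile> A \<Colon> Cst s\<^sub>1 \<Longrightarrow> s\<^sub>1 \<in> sorts X \<Longrightarrow> A # \<Gamma> \<turnstile> B \<Colon> Cst s\<^sub>2 \<Longrightarrow> s\<^sub>2 \<in> sorts X \<Longrightarrow>
    \<Gamma> \<turnstile> App M N \<Colon> subst B N 0"
| abstraction: "A # \<Gamma> \<turnstile> M \<Colon> B \<Longrightarrow> \<Gamma> \<turnstile> Prd A B \<Colon> Cst s \<Longrightarrow> s \<in> sorts X \<Longrightarrow>
    \<Gamma> \<turnstile> Abs A M \<Colon> Prd A B"
| product: "A # \<Gamma> \<turnstile> B \<Colon> Cst s\<^sub>2 \<Longrightarrow> \<Gamma> \<turnstile> A \<Colon> Cst s\<^sub>1 \<Longrightarrow> (s\<^sub>1, s\<^sub>2, s\<^sub>3) \<in> rules X \<Longrightarrow>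
    \<Gamma> \<turnstile> Prd A B \<Colon> Cst s\<^sub>3"
| conversion: "\<Gamma> \<turnstile> M \<Colon> A \<Longrightarrow> \<Gamma> \<turnstile> B \<Colon> Cst s \<Longrightarrow> s \<in> sorts X \<Longrightarrow> A =\<^sub>\<beta> B \<Longrightarrow> \<Gamma> \<turnstile> M \<Colon> B"

text \<open>The judgement on \<open>M\<close> only witnesses that \<open>\<Gamma>\<close> is a legal
  context.\<close>

lemma judg_constant:
  assumes "\<Gamma> \<turnstile> M \<Colon> B" and "(c, s) \<in> axioms X"
  shows "\<Gamma> \<turnstile> Cst c \<Colon> Cst s"
  using assms
proof induct
  case (start \<Gamma> A s')
  then show ?case using judg.weakening[of \<Gamma> "Cst c" "Cst s" A s'] by simp
next
  case (weakening \<Gamma> M B A s')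
  then show ?case using judg.weakening[of \<Gamma> "Cst c" "Cst s" A s'] by simp
qed (auto intro: judg.axiom)

text \<open>Only start and weakening extend a context, and both type the new declaration. Every
  other rule concluding in a nonempty context has a premise in the same context.\<close>

lemma judg_head_sort:
  assumes "A # \<Gamma> \<turnstile> M \<Colon> B"
  shows "\<exists>s\<in>sorts X. \<Gamma> \<turnstile> A \<Colon> Cst s"
  using assms by (induct "A # \<Gamma>" M B) auto

section \<open>Thinning and substitution\<close>

primrec lift_ctxt :: "'c ctxt \<Rightarrow> 'c ctxt" where
  "lift_ctxt [] = []"
| "lift_ctxt (A # \<Delta>) = lift A (length \<Delta>) # lift_ctxt \<Delta>"

abbreviation lift0 :: "nat \<Rightarrow> 'c trm \<Rightarrow> 'c trm" where
  "lift0 k \<equiv> (\<lambda>t. lift t 0) ^^ k"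

text \<open>Each type in the block lives over the declarations after it in the list. Their number is
  therefore both the index to be replaced and the shift that brings \<open>N\<close> there;
  \<open>lift_ctxt\<close> finds its cut-offs in the same way.\<close>

primrec subst_ctxt :: "'c trm \<Rightarrow> 'c ctxt \<Rightarrow> 'c ctxt" where
  "subst_ctxt N [] = []"
| "subst_ctxt N (A # \<Delta>) = subst A (lift0 (length \<Delta>) N) (length \<Delta>) # subst_ctxt N \<Delta>"

text \<open>The declaration \<open>C\<close> is inserted below an arbitrary block
  \<open>\<Delta>\<close>, because premises under a binder extend the block.\<close>

lemma thinning_append:
  assumes "\<Gamma> \<turnstile> M \<Colon> B" and "\<Gamma> = \<Delta> @ \<Gamma>'" and C: "\<Gamma>' \<turnstile> C \<Colon> Cst s" "s \<in> sorts X"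
  shows "lift_ctxt \<Delta> @ C # \<Gamma>' \<turnstile> lift M (length \<Delta>) \<Colon> lift B (length \<Delta>)"
  using assms(1,2)
proof (induct arbitrary: \<Delta>)
  case (axiom c s')
  then show ?case using judg.weakening[OF judg.axiom[OF axiom(1)]] C by fastforce
next
  case (start \<Gamma> A s')
  show ?case
  proof (cases \<Delta>)
    case Nil
    then show ?thesis using judg.weakening[OF judg.start[OF start(1,3)]] C start(4) by auto
  next
    case (Cons A' \<Delta>')
    then show ?thesis
      using start(4) judg.start[OF start(2)[of \<Delta>', simplified] start(3)]
      by (auto simp: lift_lift)
  qed
next
  case (weakening \<Gamma> M B A s')
  show ?case
  proof (cases \<Delta>)
    case Nil
    then show ?thesis
      using judg.weakening[OF judg.weakening[OF weakening(1,3,5)]] C weakening(6) by auto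
  next
    case (Cons A' \<Delta>')
    then show ?thesis
      using weakening(6) judg.weakening[OF weakening(2)[of \<Delta>'] weakening(4)[of \<Delta>', simplified] weakening(5)]
      by (auto simp: lift_lift)
  qed
next
  case (application \<Gamma> M A B N s\<^sub>1 s\<^sub>2)
  then show ?case
    using judg.application[of "lift_ctxt \<Delta> @ C # \<Gamma>'" "lift M (length \<Delta>)" "lift A (length \<Delta>)"
        "lift B (Suc (length \<Delta>))" "lift N (length \<Delta>)" s\<^sub>1 s\<^sub>2] application(9)[of "A # \<Delta>"]
    by (simp add: lift_subst)
next
  case (abstraction A \<Gamma> M B s')
  then show ?case
    using abstraction(2)[of "A # \<Delta>"] by (auto intro: judg.abstraction)
next
  case (product A \<Gamma> B s\<^sub>2 s\<^sub>1 s\<^sub>3)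
  then show ?case
    using product(2)[of "A # \<Delta>"] by (auto intro: judg.product)
next
  case (conversion \<Gamma> M A B s')
  then show ?case
    by (auto intro!: judg.conversion[of _ _ "lift A (length \<Delta>)" "lift B (length \<Delta>)" s']
        equivclp_map[of beta beta "\<lambda>t. lift t _"] beta_lift)
qed

lemma substitution_append:
  assumes "\<Gamma> \<turnstile> M \<Colon> B" and "\<Gamma> = \<Delta> @ C # \<Gamma>'" and N: "\<Gamma>' \<turnstile> N \<Colon> C"
  shows "subst_ctxt N \<Delta> @ \<Gamma>' \<turnstile>
    subst M (lift0 (length \<Delta>) N) (length \<Delta>) \<Colon> subst B (lift0 (length \<Delta>) N) (length \<Delta>)"
  using assms(1,2)
proof (induct arbitrary: \<Delta>)
  case (start \<Gamma> A s')
  show ?case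
  proof (cases \<Delta>)
    \<comment> \<open>The variable is the replaced one: the subject becomes \<open>N\<close>, and
      its type \<open>lift A 0\<close> loses its shift.\<close>
    case Nil
    then show ?thesis using start N by auto
  next
    case (Cons A' \<Delta>')
    then show ?thesis
      using start(4) judg.start[OF start(2)[of \<Delta>', simplified] start(3)]
      by (auto simp: lift_subst_lt)
  qed
next
  case (weakening \<Gamma> M B A s')
  show ?case
  proof (cases \<Delta>)
    case Nil
    then show ?thesis
      using weakening by auto
  next
    case (Cons A' \<Delta>')
    then show ?thesis
      using weakening(6) judg.weakening[OF weakening(2)[of \<Delta>'] weakening(4)[of \<Delta>', simplified] weakening(5)]
      by (auto simp: lift_subst_lt)
  qed
next
  case (application \<Gamma> M A B P s\<^sub>1 s\<^sub>2)
  then show ?case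
    using judg.application[of "subst_ctxt N \<Delta> @ \<Gamma>'" "subst M (lift0 (length \<Delta>) N) (length \<Delta>)"
        "subst A (lift0 (length \<Delta>) N) (length \<Delta>)" 
        "subst B (lift0 (Suc (length \<Delta>)) N) (Suc (length \<Delta>))"
        "subst P (lift0 (length \<Delta>) N) (length \<Delta>)" s\<^sub>1 s\<^sub>2] application(9)[of "A # \<Delta>"]
    by (simp add: subst_subst)
next
  case (abstraction A \<Gamma> M B s')
  then show ?case
    using abstraction(2)[of "A # \<Delta>"] by (auto intro: judg.abstraction)
next
  case (product A \<Gamma> B s\<^sub>2 s\<^sub>1 s\<^sub>3)
  then show ?case
    using product(2)[of "A # \<Delta>"] by (auto intro: judg.product)
next
  case (conversion \<Gamma> M A B s')
  then show ?case
    by (auto intro!: judg.conversion[of _ _ "subst A (lift0 (length \<Delta>) N) (length \<Delta>)"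
          "subst B (lift0 (length \<Delta>) N) (length \<Delta>)" s']
        equivclp_map[of beta beta "\<lambda>t. subst t _ _"] beta_subst)
qed simp

lemma substitution: "C # \<Gamma> \<turnstile> M \<Colon> B \<Longrightarrow> \<Gamma> \<turnstile> N \<Colon> C \<Longrightarrow> \<Gamma> \<turnstile> subst M N 0 \<Colon> subst B N 0"
  using substitution_append[of "C # \<Gamma>" M B "[]" C \<Gamma> N] by simp

text \<open>Correctness of types. The usual exception of a top sort without a type disappears, since
  every constant has a sort by supersortedness.\<close>

lemma judg_type_sort:
  assumes "\<Gamma> \<turnstile> M \<Colon> B"
  shows "\<exists>s\<in>sorts X. \<Gamma> \<turnstile> B \<Colon> Cst s"
  using assms
proof induct
  case (axiom c s)
  then show ?case using ex_axiom[of s] by (auto intro: judg.axiom)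
next
  case (start \<Gamma> A s)
  then show ?case using judg.weakening[OF start(1,1,3)] by auto
next
  case (weakening \<Gamma> M B A s)
  then obtain s' where "s' \<in> sorts X" "\<Gamma> \<turnstile> B \<Colon> Cst s'" by blast
  with judg.weakening[OF this(2) weakening(3,5)] show ?case by auto
next
  case (application \<Gamma> M A B N s\<^sub>1 s\<^sub>2)
  then show ?case using substitution[of A \<Gamma> B "Cst s\<^sub>2" N] by auto
next
  case (product A \<Gamma> B s\<^sub>2 s\<^sub>1 s\<^sub>3)
  then show ?case using ex_axiom[of s\<^sub>3] by (auto intro: judg_constant)
qed auto

section \<open>Generation lemmas and subject reduction\<close>

lemma judg_Prd_inv:
  assumes "\<Gamma> \<turnstile> Prd A B \<Colon> C"
  shows "\<exists>s\<^sub>1\<in>sorts X. \<exists>s\<^sub>2\<in>sorts X. \<Gamma> \<turnstile> A \<Colon> Cst s\<^sub>1 \<and> A # \<Gamma> \<turnstile> B \<Colon> Cst s\<^sub>2"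
  using assms
proof (induct \<Gamma> "Prd A B" C arbitrary: A B)
  case (weakening \<Gamma> M C D s)
  then obtain A' B' where M: "M = Prd A' B'" "A = lift A' 0" "B = lift B' 1"
    by (metis lift_eq_Prd One_nat_def)
  with weakening obtain s\<^sub>1 s\<^sub>2 where *: "s\<^sub>1 \<in> sorts X" "s\<^sub>2 \<in> sorts X"
    "\<Gamma> \<turnstile> A' \<Colon> Cst s\<^sub>1" "A' # \<Gamma> \<turnstile> B' \<Colon> Cst s\<^sub>2"
    by blast
  \<comment> \<open>\<open>B'\<close> lives under its own binder, so the new declaration is inserted
    below \<open>A'\<close> by thinning.\<close>
  show ?case
    using * M judg.weakening[OF *(3) weakening(3,5)]
      thinning_append[OF *(4), of "[A']" \<Gamma> D s] weakening(3,5)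
    by auto
qed (use rule_sorts in blast)+

lemma judg_Abs_inv:
  assumes "\<Gamma> \<turnstile> Abs A M \<Colon> C"
  shows "\<exists>B. \<exists>s\<in>sorts X. A # \<Gamma> \<turnstile> M \<Colon> B \<and> \<Gamma> \<turnstile> Prd A B \<Colon> Cst s \<and> Prd A B =\<^sub>\<beta> C"
  using assms
proof (induct \<Gamma> "Abs A M" C arbitrary: A M)
  case (weakening \<Gamma> M' C D s)
  then obtain A' M'' where M: "M' = Abs A' M''" "A = lift A' 0" "M = lift M'' 1"
    by (metis lift_eq_Abs One_nat_def)
  with weakening obtain B s' where *: "s' \<in> sorts X" "A' # \<Gamma> \<turnstile> M'' \<Colon> B"
    "\<Gamma> \<turnstile> Prd A' B \<Colon> Cst s'" "Prd A' B =\<^sub>\<beta> C"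
    by blast
  have "lift (Prd A' B) 0 =\<^sub>\<beta> lift C 0"
    using *(4) by (rule equivclp_map[of beta, rotated]) (rule beta_lift)
  then show ?case
    using * M judg.weakening[OF *(3) weakening(3,5)]
      thinning_append[OF *(2), of "[A']" \<Gamma> D s] weakening(3,5)
    by (auto intro!: exI[of _ "lift B 1"])
qed (blast intro: equivclp_refl equivclp_trans)+

text \<open>The declaration \<open>A'\<close> is inserted below \<open>A\<close>, and its variable,
  converted to the type \<open>lift A 0\<close>, is substituted for the old head variable. By
  \<open>subst_lift_Var\<close> the terms \<open>M\<close> and \<open>B\<close> come back
  unchanged.\<close>

lemma judg_convert_head:
  assumes "A # \<Gamma> \<turnstile> M \<Colon> B" and A': "\<Gamma> \<turnstile> A' \<Colon> Cst s" "s \<in> sorts X" and "A =\<^sub>\<beta> A'"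
  shows "A' # \<Gamma> \<turnstile> M \<Colon> B"
proof -
  obtain s' where s': "s' \<in> sorts X" "\<Gamma> \<turnstile> A \<Colon> Cst s'"
    using assms(1) judg_head_sort by blast
  have "lift A' 0 =\<^sub>\<beta> lift A 0"
    by (rule equivclp_map[of beta beta "\<lambda>t. lift t 0", OF beta_lift equivclp_sym[OF assms(4)]])
  then have "A' # \<Gamma> \<turnstile> Var 0 \<Colon> lift A 0"
    using judg.conversion[OF judg.start[OF A'], of "lift A 0" s']
      judg.weakening[OF s'(2) A'] s'(1) by simp
  moreover have "lift A 0 # A' # \<Gamma> \<turnstile> lift M 1 \<Colon> lift B 1"
    using thinning_append[OF assms(1), of "[A]" \<Gamma>] A' by simp
  ultimately show ?thesis
    using substitution by fastforce
qed

text \<open>Only the subject is reduced: when the domain of a binder changes,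
  \<open>judg_convert_head\<close> moves the body into the new context.\<close>

lemma judg_subject_reduction:
  assumes "\<Gamma> \<turnstile> M \<Colon> B" and "M \<rightarrow>\<^sub>\<beta> M'"
  shows "\<Gamma> \<turnstile> M' \<Colon> B"
  using assms
proof (induct arbitrary: M')
  case (weakening \<Gamma> M B A s)
  then show ?case by (blast dest: beta_lift_inv intro: judg.weakening)
next
  case (application \<Gamma> M A B N s\<^sub>1 s\<^sub>2)
  from \<open>App M N \<rightarrow>\<^sub>\<beta> M'\<close> consider
    (1) A\<^sub>0 P where "M = Abs A\<^sub>0 P" "M' = subst P N 0" |
    (2) M'' where "M' = App M'' N" "M \<rightarrow>\<^sub>\<beta> M''" |
    (3) N' where "M' = App M N'" "N \<rightarrow>\<^sub>\<beta> N'"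
    by (blast elim: beta_AppE)
  then show ?case
  proof cases
    case (1 A\<^sub>0 P)
    \<comment> \<open>Generation types the body of the redex over \<open>A\<^sub>0\<close>.
      Injectivity of products relates domain and codomain to \<open>A\<close> and \<open>B\<close>,
      so that \<open>N\<close> can be converted to the domain \<open>A\<^sub>0\<close> and the
      result back.\<close>
    obtain B\<^sub>0 s where *: "s \<in> sorts X" "A\<^sub>0 # \<Gamma> \<turnstile> P \<Colon> B\<^sub>0" "Prd A\<^sub>0 B\<^sub>0 =\<^sub>\<beta> Prd A B"
      using application(1) 1 judg_Abs_inv by blast
    obtain s' where s': "s' \<in> sorts X" "\<Gamma> \<turnstile> A\<^sub>0 \<Colon> Cst s'"
      using *(2) judg_head_sort by blast
    have "\<Gamma> \<turnstile> N \<Colon> A\<^sub>0"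
      using judg.conversion[OF application(3) s'(2,1)] equivclp_sym[OF beta_eq_Prd_inject(1)[OF *(3)]]
      by simp
    then have "\<Gamma> \<turnstile> subst P N 0 \<Colon> subst B\<^sub>0 N 0"
      using *(2) substitution by blast
    moreover have "subst B\<^sub>0 N 0 =\<^sub>\<beta> subst B N 0"
      using beta_eq_Prd_inject(2)[OF *(3)]
      by (intro equivclp_map[of beta beta "\<lambda>t. subst t N 0"] beta_subst)
    moreover have "\<Gamma> \<turnstile> subst B N 0 \<Colon> Cst s\<^sub>2"
      using substitution[OF application(8,3)] by simp
    ultimately show ?thesis using 1 application(10) by (auto intro: judg.conversion)
  next
    case (2 M'')
    then show ?thesis using application by (auto intro: judg.application)
  next
    case (3 N')
    then have "\<Gamma> \<turnstile> N' \<Colon> A" using application(4) by blast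
    then have "\<Gamma> \<turnstile> App M N' \<Colon> subst B N' 0"
      using application by (auto intro: judg.application)
    \<comment> \<open>The type changes along with the argument; converting it back needs
      \<open>subst B N 0\<close> to be typed.\<close>
    moreover have "subst B N' 0 =\<^sub>\<beta> subst B N 0"
      using betas_subst_arg[of N N' B 0] 3 by (auto intro: converse_rtranclp_into_equivclp)
    moreover have "\<Gamma> \<turnstile> subst B N 0 \<Colon> Cst s\<^sub>2"
      using substitution[OF application(8,3)] by simp
    ultimately show ?thesis using 3 application(10) by (auto intro: judg.conversion)
  qed
next
  case (abstraction A \<Gamma> M B s)
  from \<open>Abs A M \<rightarrow>\<^sub>\<beta> M'\<close> consider
    (1) A' where "M' = Abs A' M" "A \<rightarrow>\<^sub>\<beta> A'" | (2) M'' where "M' = Abs A M''" "M \<rightarrow>\<^sub>\<beta> M''"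
    by (blast elim: beta_AbsE)
  then show ?case
  proof cases
    case (1 A')
    then have *: "\<Gamma> \<turnstile> Prd A' B \<Colon> Cst s"
      using abstraction(4) by (blast intro: beta.PrdL)
    then obtain s' where "s' \<in> sorts X" "\<Gamma> \<turnstile> A' \<Colon> Cst s'"
      using judg_Prd_inv by blast
    then have "A' # \<Gamma> \<turnstile> M \<Colon> B"
      using judg_convert_head[OF abstraction(1)] 1 by blast
    then have "\<Gamma> \<turnstile> Abs A' M \<Colon> Prd A' B"
      using * abstraction(5) by (blast intro: judg.abstraction)
    moreover have "Prd A' B =\<^sub>\<beta> Prd A B"
      using 1 by (blast intro: beta.PrdL)
    ultimately show ?thesis
      using 1 abstraction(3,5) by (auto intro: judg.conversion)
  next
    case (2 M'')
    then show ?thesis using abstraction by (auto intro: judg.abstraction)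
  qed
next
  case (product A \<Gamma> B s\<^sub>2 s\<^sub>1 s\<^sub>3)
  from \<open>Prd A B \<rightarrow>\<^sub>\<beta> M'\<close> consider
    (1) A' where "M' = Prd A' B" "A \<rightarrow>\<^sub>\<beta> A'" | (2) B' where "M' = Prd A B'" "B \<rightarrow>\<^sub>\<beta> B'"
    by (blast elim: beta_PrdE)
  then show ?case
  proof cases
    case (1 A')
    then have "\<Gamma> \<turnstile> A' \<Colon> Cst s\<^sub>1" using product(4) by blast
    moreover then have "A' # \<Gamma> \<turnstile> B \<Colon> Cst s\<^sub>2"
      using judg_convert_head[OF product(1)] 1 rule_sorts[OF product(5)] by blast
    ultimately show ?thesis using 1 product(5) by (auto intro: judg.product)
  next
    case (2 B')
    then show ?thesis using product by (auto intro: judg.product)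
  qed
qed (blast elim: beta_VarE beta_CstE intro: judg.conversion)+

text \<open>The premises that \<open>judg\<close> adds to application are recovered from correctness
  of types and generation.\<close>

lemma derivable_iff_judg: "derivable X \<Gamma> M A \<longleftrightarrow> \<Gamma> \<turnstile> M \<Colon> A"
proof
  assume "derivable X \<Gamma> M A"
  then show "\<Gamma> \<turnstile> M \<Colon> A"
  proof induct
    case (application \<Gamma> M A B N)
    obtain s where "\<Gamma> \<turnstile> Prd A B \<Colon> Cst s" using application judg_type_sort by blast
    then obtain s\<^sub>1 s\<^sub>2 where "s\<^sub>1 \<in> sorts X" "s\<^sub>2 \<in> sorts X" "\<Gamma> \<turnstile> A \<Colon> Cst s\<^sub>1" "A # \<Gamma> \<turnstile> B \<Colon> Cst s\<^sub>2"
      using judg_Prd_inv by blast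
    then show ?case using application by (auto intro: judg.application)
  qed (auto intro: judg.intros)
next
  assume "\<Gamma> \<turnstile> M \<Colon> A"
  then show "derivable X \<Gamma> M A"
    by induct (auto intro: derivable.intros)
qed

text \<open>The easy inclusion: axiom instances are derivable by definition, and type reduction is a
  conversion whose target is typed by subject reduction.\<close>

lemma hplus_imp_judg:
  assumes "derivable_hplus X \<Gamma> M A"
  shows "\<Gamma> \<turnstile> M \<Colon> A"
  using assms
proof induct
  case (hilbert M A)
  then show ?case
    by (auto simp: hilbert_axiom_def derivable_instance_def derivable_iff_judg)
next
  case (application \<Gamma> M A B N)
  then show ?case
    by (metis derivable_iff_judg derivable.application)
next
  case (type_reduction \<Gamma> M A B)
  then obtain s where "s \<in> sorts X" "\<Gamma> \<turnstile> A \<Colon> Cst s" using judg_type_sort by blast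
  then show ?case
    using type_reduction by (blast intro: judg.conversion judg_subject_reduction)
qed (auto intro: judg.intros judg_subject_reduction)

end


section \<open>Product types and their associated families\<close>

fun prd_depth :: "nat \<Rightarrow> 'c trm \<Rightarrow> bool" where
  "prd_depth 0 T = True"
| "prd_depth (Suc n) (Prd A B) = prd_depth n B"
| "prd_depth (Suc n) T = False"

text \<open>\<open>fam n (\<Pi>x\<^sub>1:A\<^sub>1 \<dots> \<Pi>x\<^sub>n:A\<^sub>n. B) = \<lambda>x\<^sub>1:A\<^sub>1 \<dots> \<lambda>x\<^sub>n:A\<^sub>n. B\<close> and
  \<open>kind n (\<Pi>x\<^sub>1:A\<^sub>1 \<dots> \<Pi>x\<^sub>n:A\<^sub>n. B) s = \<Pi>x\<^sub>1:A\<^sub>1 \<dots> \<Pi>x\<^sub>n:A\<^sub>n. s\<close>.\<close>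

fun fam :: "nat \<Rightarrow> 'c trm \<Rightarrow> 'c trm" where
  "fam (Suc n) (Prd A B) = Abs A (fam n B)"
| "fam n T = T"

fun kind :: "nat \<Rightarrow> 'c trm \<Rightarrow> 'c \<Rightarrow> 'c trm" where
  "kind (Suc n) (Prd A B) s = Prd A (kind n B s)"
| "kind n T s = Cst s"

lemma fam_0 [simp]: "fam 0 T = T" and kind_0 [simp]: "kind 0 T s = Cst s"
  by (cases T; simp)+

lemma prd_depth_Suc: "prd_depth (Suc n) T \<longleftrightarrow> (\<exists>A B. T = Prd A B \<and> prd_depth n B)"
  by (cases T) auto

lemma prd_depth_mono: "prd_depth n T \<Longrightarrow> m \<le> n \<Longrightarrow> prd_depth m T"
proof (induct n arbitrary: m T)
  case (Suc n)
  then show ?case by (cases m) (auto simp: prd_depth_Suc)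
qed simp

lemma prd_depth_kind: "prd_depth m T \<Longrightarrow> prd_depth m (kind m T s)"
  by (induct m arbitrary: T) (auto simp: prd_depth_Suc)

lemma kind_kind: "prd_depth m T \<Longrightarrow> l \<le> m \<Longrightarrow> kind l (kind m T s) s' = kind l T s'"
proof (induct m arbitrary: T l)
  case (Suc m)
  then show ?case by (cases l) (auto simp: prd_depth_Suc)
qed simp

lemma prd_depth_subst: "prd_depth n T \<Longrightarrow> prd_depth n (subst T N k)"
  by (induct n arbitrary: T N k) (auto simp: prd_depth_Suc)

lemma fam_subst: "prd_depth n T \<Longrightarrow> fam n (subst T N k) = subst (fam n T) N k"
  by (induct n arbitrary: T N k) (auto simp: prd_depth_Suc)

lemma kind_subst: "prd_depth n T \<Longrightarrow> kind n (subst T N k) s = subst (kind n T s) N k"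
  by (induct n arbitrary: T N k) (auto simp: prd_depth_Suc)

lemma prd_depth_lift: "prd_depth n T \<Longrightarrow> prd_depth n (lift T k)"
  by (induct n arbitrary: T k) (auto simp: prd_depth_Suc)

lemma fam_lift: "prd_depth n T \<Longrightarrow> fam n (lift T k) = lift (fam n T) k"
  by (induct n arbitrary: T k) (auto simp: prd_depth_Suc)

lemma kind_lift: "prd_depth n T \<Longrightarrow> kind n (lift T k) s = lift (kind n T s) k"
  by (induct n arbitrary: T k) (auto simp: prd_depth_Suc)

lemma prd_depth_map: "prd_depth n T \<Longrightarrow> prd_depth n (map_trm f T)"
  by (induct n arbitrary: T) (auto simp: prd_depth_Suc)

lemma fam_map: "prd_depth n T \<Longrightarrow> fam n (map_trm f T) = map_trm f (fam n T)"
  by (induct n arbitrary: T) (auto simp: prd_depth_Suc)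

lemma kind_map: "prd_depth n T \<Longrightarrow> kind n (map_trm f T) (f s) = map_trm f (kind n T s)"
  by (induct n arbitrary: T) (auto simp: prd_depth_Suc)

lemma fam_beta: "prd_depth n T \<Longrightarrow> T \<rightarrow>\<^sub>\<beta> T' \<Longrightarrow> fam n T \<rightarrow>\<^sub>\<beta> fam n T'"
  by (induct n arbitrary: T T') (auto simp: prd_depth_Suc elim!: beta_PrdE intro!: beta.AbsR intro: beta.AbsL)

lemma prd_depth_beta: "prd_depth n T \<Longrightarrow> T \<rightarrow>\<^sub>\<beta> T' \<Longrightarrow> prd_depth n T'"
  by (induct n arbitrary: T T') (auto simp: prd_depth_Suc elim!: beta_PrdE)

text \<open>A step below the first \<open>n\<close> products is lost when the body is replaced by a
  sort, hence the reflexive closure.\<close>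

lemma kind_beta: "prd_depth n T \<Longrightarrow> T \<rightarrow>\<^sub>\<beta> T' \<Longrightarrow> kind n T s \<rightarrow>\<^sub>\<beta>\<^sup>* kind n T' s"
  by (induct n arbitrary: T T')
    (auto simp: prd_depth_Suc elim!: beta_PrdE intro!: betas_Prd)

text \<open>Translates the recursion of \<open>fam\<close> and \<open>kind\<close> into the
  telescopes in which closure rule (II) is phrased.\<close>

lemma prd_depth_Prds: "prd_depth n T \<longleftrightarrow> (\<exists>\<Delta> B. length \<Delta> = n \<and> T = Prds \<Delta> B)"
proof (induct n arbitrary: T)
  case (Suc n)
  show ?case
  proof
    assume "prd_depth (Suc n) T"
    then obtain A \<Delta> B where "T = Prd A (Prds \<Delta> B)" "length \<Delta> = n"
      using Suc by (auto simp: prd_depth_Suc)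
    then show "\<exists>\<Delta> B. length \<Delta> = Suc n \<and> T = Prds \<Delta> B"
      by (auto intro!: exI[of _ "A # \<Delta>"])
  next
    assume "\<exists>\<Delta> B. length \<Delta> = Suc n \<and> T = Prds \<Delta> B"
    then show "prd_depth (Suc n) T"
      using Suc by (fastforce simp: length_Suc_conv prd_depth_Suc)
  qed
qed simp

lemma fam_Prds: "fam (length \<Delta>) (Prds \<Delta> B) = Abss \<Delta> B"
  by (induct \<Delta>) auto

lemma kind_Prds: "kind (length \<Delta>) (Prds \<Delta> B) s = Prds \<Delta> (Cst s)"
  by (induct \<Delta>) auto

lemma finite_set_trm: "finite (set_trm T)"
  by (induct T) auto

lemma in_set_kind: "prd_depth n T \<Longrightarrow> s \<in> set_trm (kind n T s)"
  by (induct n arbitrary: T) (auto simp: prd_depth_Suc)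


section \<open>The Hilbert-style system with typed applications\<close>

context supersorted_pts
begin

text \<open>Each new abstraction needs its kind typed, and supersortedness supplies a rule for every
  product in it.\<close>

lemma judg_fam:
  assumes "\<Gamma> \<turnstile> T \<Colon> Cst s" "s \<in> sorts X" "prd_depth m T"
  shows "\<exists>s'\<in>sorts X. \<Gamma> \<turnstile> fam m T \<Colon> kind m T s'"
  using assms
proof (induct m arbitrary: \<Gamma> T s)
  case (Suc m)
  then obtain A B where T: "T = Prd A B" "prd_depth m B" by (auto simp: prd_depth_Suc)
  with Suc(2) obtain s\<^sub>1 s\<^sub>2 where s: "s\<^sub>1 \<in> sorts X" "s\<^sub>2 \<in> sorts X" "\<Gamma> \<turnstile> A \<Colon> Cst s\<^sub>1" "A # \<Gamma> \<turnstile> B \<Colon> Cst s\<^sub>2"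
    using judg_Prd_inv by blast
  with Suc(1) T obtain s' where s': "s' \<in> sorts X" "A # \<Gamma> \<turnstile> fam m B \<Colon> kind m B s'" by blast
  then obtain s'' where s'': "s'' \<in> sorts X" "A # \<Gamma> \<turnstile> kind m B s' \<Colon> Cst s''" using judg_type_sort by blast
  obtain s\<^sub>3 where "s\<^sub>3 \<in> sorts X" "(s\<^sub>1, s'', s\<^sub>3) \<in> rules X" using ex_rule s s'' by blast
  then show ?case using s s' s'' T by (auto intro: judg.abstraction judg.product)
qed auto

lemma judg_kind:
  assumes "\<Gamma> \<turnstile> T \<Colon> Cst s" "prd_depth m T"
  shows "\<exists>s'\<in>sorts X. \<Gamma> \<turnstile> kind m T c \<Colon> Cst s'"
  using assms
proof (induct m arbitrary: \<Gamma> T s)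
  case (Suc m)
  then obtain A B where T: "T = Prd A B" "prd_depth m B" by (auto simp: prd_depth_Suc)
  with Suc(2) obtain s\<^sub>1 s\<^sub>2 where s: "s\<^sub>1 \<in> sorts X" "s\<^sub>2 \<in> sorts X" "\<Gamma> \<turnstile> A \<Colon> Cst s\<^sub>1" "A # \<Gamma> \<turnstile> B \<Colon> Cst s\<^sub>2"
    using judg_Prd_inv by blast
  with Suc(1) T obtain s'' where s'': "s'' \<in> sorts X" "A # \<Gamma> \<turnstile> kind m B c \<Colon> Cst s''" by blast
  obtain s\<^sub>3 where "s\<^sub>3 \<in> sorts X" "(s\<^sub>1, s'', s\<^sub>3) \<in> rules X" using ex_rule s s'' by blast
  then show ?case using s s'' T by (auto intro: judg.product)
next
  case 0
  then show ?case using ex_axiom[of c] by (auto intro: judg_constant)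
qed

lemma map_trm_upd: "j \<notin> set_trm T \<Longrightarrow> map_trm (\<sigma>(j := s)) T = map_trm \<sigma> T"
  by (rule trm.map_cong) auto

lemma sort_valuation_upd: "sort_valuation X \<sigma> \<Longrightarrow> s \<in> sorts X \<Longrightarrow> sort_valuation X (\<sigma>(j := s))"
  by (simp add: sort_valuation_def)

text \<open>Closure rule (I), with no occurrence replaced, turns the type \<open>T\<close> into a
  scheme, and each use of (II) turns one more leading product into an abstraction. The derivable
  instances they demand come from the typing of \<open>T\<close> and from \<open>judg_fam\<close>:
  since \<open>j\<close> does not occur in \<open>T\<close>, \<open>\<sigma>\<close> can be
  redefined at \<open>j\<close> as the sort found there.\<close>

lemma scheme_fam:
  assumes "scheme X M T" "prd_depth n T" "0 < n" "sort_valuation X \<sigma>"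
    and T: "[] \<turnstile> map_trm \<sigma> T \<Colon> Cst s" "s \<in> sorts X" and j: "j \<notin> set_trm T" and "m \<le> n"
  shows "scheme X (fam m T) (kind m T j)"
  using \<open>m \<le> n\<close>
proof (induct m)
  case 0
  have "derivable_instance X (\<sigma>(j := s)) T (Cst j)"
    using T j assms(4) by (simp add: derivable_instance_def derivable_iff_judg map_trm_upd sort_valuation_upd)
  moreover have "\<forall>i. T \<noteq> Cst i" using assms(2,3) by (cases n) auto
  ultimately show ?case
    using scheme.closure_I[OF assms(1), of T j] by (auto simp: replaces_repeated_def)
next
  case (Suc m)
  then have d: "prd_depth (Suc m) T" "prd_depth m T" using prd_depth_mono[OF assms(2)] by auto
  then obtain \<Delta>' B where "length \<Delta>' = Suc m" "T = Prds \<Delta>' B"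
    by (auto simp: prd_depth_Prds simp del: prd_depth.simps)
  then obtain \<Delta> A where \<Delta>: "length \<Delta> = m" "T = Prds \<Delta> (Prd A B)" "T = Prds (\<Delta> @ [A]) B"
    by (cases \<Delta>' rule: rev_cases) auto
  have fk: "fam m T = Abss \<Delta> (Prd A B)" "kind m T j = Prds \<Delta> (Cst j)"
    using \<Delta> fam_Prds[of \<Delta> "Prd A B"] kind_Prds[of \<Delta> "Prd A B"] by auto
  have fk': "fam (Suc m) T = Abss (\<Delta> @ [A]) B" "kind (Suc m) T j = Prds (\<Delta> @ [A]) (Cst j)"
    unfolding \<Delta>(3) using \<Delta>(1) fam_Prds[of "\<Delta> @ [A]" B] kind_Prds[of "\<Delta> @ [A]" B] by auto
  obtain s' where s': "s' \<in> sorts X"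
    "[] \<turnstile> fam (Suc m) (map_trm \<sigma> T) \<Colon> kind (Suc m) (map_trm \<sigma> T) s'"
    using judg_fam[OF T prd_depth_map[OF d(1)]] by blast
  let ?\<sigma> = "\<sigma>(j := s')"
  have "[] \<turnstile> map_trm ?\<sigma> (fam (Suc m) T) \<Colon> map_trm ?\<sigma> (kind (Suc m) T j)"
    using s' fam_map[OF d(1), of ?\<sigma>] kind_map[OF d(1), of ?\<sigma> j] by (simp add: map_trm_upd[OF j])
  then have "derivable_instance X ?\<sigma> (fam (Suc m) T) (kind (Suc m) T j)"
    using s' assms(4) by (simp add: derivable_instance_def derivable_iff_judg sort_valuation_upd)
  then show ?case
    using scheme.closure_II[of X \<Delta> A B j j] Suc fk unfolding fk' by auto
qed

lemma hilbert_fam: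
  assumes "scheme X M T" "prd_depth n T" "0 < n" "sort_valuation X \<sigma>"
    and T: "[] \<turnstile> map_trm \<sigma> T \<Colon> Cst s" "s \<in> sorts X" and "m \<le> n"
  shows "\<exists>s'\<in>sorts X. hilbert_axiom X (fam m (map_trm \<sigma> T)) (kind m (map_trm \<sigma> T) s')"
proof -
  have d: "prd_depth m T" using assms(2,7) prd_depth_mono by blast
  \<comment> \<open>The sort variables 1, 2, 3 of \<open>Pi1_ty\<close> are avoided:
    \<open>j\<close> occurs in the kind below but not in \<open>Pi1_ty\<close>, which discharges the
    side condition of the scheme for products.\<close>
  obtain j where "j \<notin> set_trm T \<union> {1,2,3}"
    using ex_new_if_finite[of "set_trm T \<union> {1,2,3}"] finite_set_trm by fastforce
  then have j: "j \<notin> set_trm T" "j \<notin> set_trm Pi1_ty"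
    by (auto simp: Pi1_ty_def Pi1_tele_def)
  obtain s' where s': "s' \<in> sorts X" "[] \<turnstile> fam m (map_trm \<sigma> T) \<Colon> kind m (map_trm \<sigma> T) s'"
    using judg_fam[OF T prd_depth_map[OF d]] by blast
  let ?\<sigma> = "\<sigma>(j := s')"
  have *: "map_trm ?\<sigma> (fam m T) = fam m (map_trm \<sigma> T)" "map_trm ?\<sigma> (kind m T j) = kind m (map_trm \<sigma> T) s'"
    using fam_map[OF d, of ?\<sigma>] kind_map[OF d, of ?\<sigma> j] by (simp_all add: map_trm_upd[OF j(1)])
  then have "derivable_instance X ?\<sigma> (fam m T) (kind m T j)"
    using s' assms(4) by (simp add: derivable_instance_def derivable_iff_judg sort_valuation_upd)
  moreover have "kind m T j \<noteq> Pi1_ty"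
    using in_set_kind[OF d, of j] j(2) by auto
  ultimately have "hilbert_axiom X (fam m (map_trm \<sigma> T)) (kind m (map_trm \<sigma> T) s')"
    unfolding hilbert_axiom_def using scheme_fam[OF assms(1-6) j(1) assms(7)] *
    by (intro exI[of _ ?\<sigma>] exI[of _ "fam m T"] exI[of _ "kind m T j"]) auto
  then show ?thesis using s' by blast
qed

text \<open>Compared with \<^const>\<open>derivable_hplus\<close>, the type in a weakening and the product type in an
  application are typed by subderivations. This is what eliminating a variable from a derivation
  with \<open>K1\<close> and \<open>S1\<close> needs.\<close>

inductive hjudg :: "'c ctxt \<Rightarrow> 'c trm \<Rightarrow> 'c trm \<Rightarrow> bool" (\<open>_ \<tturnstile> _ \<Colon> _\<close> [51, 51, 51] 50) where
  axiom: "(c, s) \<in> axioms X \<Longrightarrow> [] \<tturnstile> Cst c \<Colon> Cst s"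
| hilbert: "hilbert_axiom X M A \<Longrightarrow> [] \<tturnstile> M \<Colon> A"
| start: "\<Gamma> \<tturnstile> A \<Colon> Cst s \<Longrightarrow> s \<in> sorts X \<Longrightarrow> A # \<Gamma> \<tturnstile> Var 0 \<Colon> lift A 0"
| weakening: "\<Gamma> \<tturnstile> M \<Colon> B \<Longrightarrow> \<Gamma> \<tturnstile> B \<Colon> Cst s' \<Longrightarrow> s' \<in> sorts X \<Longrightarrow>
    \<Gamma> \<tturnstile> A \<Colon> Cst s \<Longrightarrow> s \<in> sorts X \<Longrightarrow> A # \<Gamma> \<tturnstile> lift M 0 \<Colon> lift B 0"
| application: "\<Gamma> \<tturnstile> M \<Colon> Prd A B \<Longrightarrow> \<Gamma> \<tturnstile> N \<Colon> A \<Longrightarrow> \<Gamma> \<tturnstile> A \<Colon> Cst s\<^sub>1 \<Longrightarrow> s\<^sub>1 \<in> sorts X \<Longrightarrow>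
    \<Gamma> \<tturnstile> Abs A B \<Colon> Prd A (Cst s\<^sub>2) \<Longrightarrow> s\<^sub>2 \<in> sorts X \<Longrightarrow> \<Gamma> \<tturnstile> Prd A B \<Colon> Cst s\<^sub>3 \<Longrightarrow> s\<^sub>3 \<in> sorts X \<Longrightarrow>
    \<Gamma> \<tturnstile> Prd A (Cst s\<^sub>2) \<Colon> Cst s\<^sub>4 \<Longrightarrow> s\<^sub>4 \<in> sorts X \<Longrightarrow> \<Gamma> \<tturnstile> App M N \<Colon> subst B N 0"
| conversion: "\<Gamma> \<tturnstile> M \<Colon> A \<Longrightarrow> \<Gamma> \<tturnstile> B \<Colon> Cst s \<Longrightarrow> s \<in> sorts X \<Longrightarrow> A =\<^sub>\<beta> B \<Longrightarrow> \<Gamma> \<tturnstile> M \<Colon> B"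
| type_reduction: "\<Gamma> \<tturnstile> M \<Colon> A \<Longrightarrow> A \<rightarrow>\<^sub>\<beta> B \<Longrightarrow> \<Gamma> \<tturnstile> M \<Colon> B"
| subject_reduction: "\<Gamma> \<tturnstile> M \<Colon> A \<Longrightarrow> M \<rightarrow>\<^sub>\<beta> N \<Longrightarrow> \<Gamma> \<tturnstile> N \<Colon> A"

lemma hjudg_imp_hplus: "\<Gamma> \<tturnstile> M \<Colon> A \<Longrightarrow> derivable_hplus X \<Gamma> M A"
  by (induct rule: hjudg.induct) (blast intro: derivable_hplus.intros)+

lemma hjudg_reduce: "\<Gamma> \<tturnstile> M \<Colon> A \<Longrightarrow> M \<rightarrow>\<^sub>\<beta>\<^sup>* M' \<Longrightarrow> A \<rightarrow>\<^sub>\<beta>\<^sup>* A' \<Longrightarrow> \<Gamma> \<tturnstile> M' \<Colon> A'"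
proof -
  assume "M \<rightarrow>\<^sub>\<beta>\<^sup>* M'" and "A \<rightarrow>\<^sub>\<beta>\<^sup>* A'" and M: "\<Gamma> \<tturnstile> M \<Colon> A"
  from this(1) M have "\<Gamma> \<tturnstile> M' \<Colon> A" by induct (auto intro: hjudg.subject_reduction)
  with \<open>A \<rightarrow>\<^sub>\<beta>\<^sup>* A'\<close> show ?thesis by induct (auto intro: hjudg.type_reduction)
qed

lemma hjudg_head_sort:
  assumes "A # \<Gamma> \<tturnstile> M \<Colon> B"
  shows "\<exists>s\<in>sorts X. \<Gamma> \<tturnstile> A \<Colon> Cst s"
  using assms by (induct "A # \<Gamma>" M B) auto

lemma hjudg_constant: "\<Gamma> \<tturnstile> M \<Colon> B \<Longrightarrow> (c, s) \<in> axioms X \<Longrightarrow> \<Gamma> \<tturnstile> Cst c \<Colon> Cst s"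
proof (induct \<Gamma> arbitrary: M B c s)
  case Nil
  then show ?case by (blast intro: hjudg.axiom)
next
  case (Cons A \<Gamma>)
  obtain t where t: "t \<in> sorts X" "\<Gamma> \<tturnstile> A \<Colon> Cst t" using hjudg_head_sort Cons by blast
  obtain s' where s': "s' \<in> sorts X" "(s, s') \<in> axioms X" using ex_axiom by blast
  show ?case
    using hjudg.weakening[OF Cons(1)[OF t(2) Cons(3)] Cons(1)[OF t(2) s'(2)] s'(1) t(2,1)] by simp
qed

lemma hjudg_constant_sort: "\<Gamma> \<tturnstile> M \<Colon> B \<Longrightarrow> \<exists>s\<in>sorts X. \<Gamma> \<tturnstile> Cst c \<Colon> Cst s"
  using ex_axiom hjudg_constant by blast

text \<open>What must be known about \<open>T\<close> to apply a term of type \<open>T\<close> to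
  \<open>n\<close> arguments in \<open>hjudg\<close>. Each application needs the product and its
  family typed. The families of the resulting type arise by applying the old families, whose types
  are kinds, so the kinds need typed families too. There the regress stops, since the families of
  kinds have kinds of \<open>T\<close> as types.\<close>

definition typed_fams :: "'c ctxt \<Rightarrow> nat \<Rightarrow> 'c trm \<Rightarrow> bool" where
  "typed_fams \<Gamma> n T \<longleftrightarrow> prd_depth n T \<and>
     (\<forall>m\<le>n. \<exists>s\<in>sorts X. \<Gamma> \<tturnstile> fam m T \<Colon> kind m T s) \<and>
     (\<forall>m\<le>n. \<forall>s\<in>sorts X. \<forall>l\<le>m. \<exists>s'\<in>sorts X. \<Gamma> \<tturnstile> fam l (kind m T s) \<Colon> kind l T s')"

text \<open>The two closure rules provide these families for every scheme.\<close>

lemma typed_fams_scheme: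
  assumes "scheme X M T" "prd_depth n T" "0 < n" "sort_valuation X \<sigma>"
    and T: "[] \<turnstile> map_trm \<sigma> T \<Colon> Cst s" "s \<in> sorts X"
  shows "typed_fams [] n (map_trm \<sigma> T)"
  unfolding typed_fams_def
proof (intro conjI allI impI ballI)
  show "prd_depth n (map_trm \<sigma> T)" using assms(2) by (rule prd_depth_map)
  show "\<exists>s\<in>sorts X. [] \<tturnstile> fam m (map_trm \<sigma> T) \<Colon> kind m (map_trm \<sigma> T) s" if "m \<le> n" for m
    using hilbert_fam[OF assms that] by (blast intro: hjudg.hilbert)
  show "\<exists>s'\<in>sorts X. [] \<tturnstile> fam l (kind m (map_trm \<sigma> T) s) \<Colon> kind l (map_trm \<sigma> T) s'"
    if "m \<le> n" "s \<in> sorts X" "l \<le> m" for m s l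
  proof (cases m)
    \<comment> \<open>A bare sort is outside closure rule (I) and is typed by an axiom.\<close>
    case 0
    then show ?thesis using that ex_axiom[of s] by (auto intro: hjudg.axiom)
  next
    case (Suc m')
    have d: "prd_depth m T" using that assms(2) prd_depth_mono by blast
    obtain j where j: "j \<notin> set_trm T"
      using ex_new_if_finite[OF _ finite_set_trm] infinite_UNIV_nat by blast
    \<comment> \<open>The kind is the type of the scheme for the family, so
      \<open>hilbert_fam\<close> applies to it in turn; \<open>s\<close> enters as the value of the
      fresh \<open>j\<close>.\<close>
    have sch: "scheme X (fam m T) (kind m T j)" by (rule scheme_fam[OF assms j that(1)])
    have m: "map_trm (\<sigma>(j := s)) (kind m T j) = kind m (map_trm \<sigma> T) s"
      using kind_map[OF d, of "\<sigma>(j := s)" j] by (simp add: map_trm_upd[OF j])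
    obtain s'' where "s'' \<in> sorts X" "[] \<turnstile> kind m (map_trm \<sigma> T) s \<Colon> Cst s''"
      using judg_kind[OF T(1) prd_depth_map[OF d]] by blast
    then show ?thesis
      using hilbert_fam[OF sch prd_depth_kind[OF d] _ sort_valuation_upd[OF assms(4) that(2), of j], of s'' l]
        that(3) Suc kind_kind[OF prd_depth_map[OF d, of \<sigma>] that(3), of s]
      unfolding m by (auto intro: hjudg.hilbert)
  qed
qed

lemma typed_fams_beta:
  assumes "typed_fams \<Gamma> n T" and "T \<rightarrow>\<^sub>\<beta> T'"
  shows "typed_fams \<Gamma> n T'"
  unfolding typed_fams_def
proof (intro conjI allI impI ballI)
  have d: "prd_depth m T" if "m \<le> n" for m
    using assms(1) that by (auto simp: typed_fams_def intro: prd_depth_mono)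
  show "prd_depth n T'" using d assms(2) prd_depth_beta by blast
  show "\<exists>s\<in>sorts X. \<Gamma> \<tturnstile> fam m T' \<Colon> kind m T' s" if m: "m \<le> n" for m
  proof -
    obtain s where "s \<in> sorts X" "\<Gamma> \<tturnstile> fam m T \<Colon> kind m T s"
      using assms(1) m by (auto simp: typed_fams_def)
    then show ?thesis
      using hjudg_reduce fam_beta[OF d[OF m] assms(2)] kind_beta[OF d[OF m] assms(2)] by blast
  qed
  show "\<exists>s'\<in>sorts X. \<Gamma> \<tturnstile> fam l (kind m T' s) \<Colon> kind l T' s'"
    if m: "m \<le> n" and s: "s \<in> sorts X" and l: "l \<le> m" for m s l
  proof -
    obtain s' where s': "s' \<in> sorts X" "\<Gamma> \<tturnstile> fam l (kind m T s) \<Colon> kind l T s'"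
      using assms(1) m s l unfolding typed_fams_def by blast
    \<comment> \<open>\<open>fam_beta\<close> requires the product depth, which is therefore carried
      along the reduction of the kind.\<close>
    have "prd_depth l U \<and> fam l (kind m T s) \<rightarrow>\<^sub>\<beta>\<^sup>* fam l U" if "kind m T s \<rightarrow>\<^sub>\<beta>\<^sup>* U" for U
      using that
    proof induct
      case base
      then show ?case using prd_depth_kind[OF d[OF m]] l prd_depth_mono by blast
    next
      case (step y z)
      then show ?case using fam_beta prd_depth_beta by (meson rtranclp.rtrancl_into_rtrancl)
    qed
    then have "fam l (kind m T s) \<rightarrow>\<^sub>\<beta>\<^sup>* fam l (kind m T' s)"
      using kind_beta[OF d[OF m] assms(2)] by blast
    then show ?thesis
      using s' hjudg_reduce kind_beta[OF d assms(2)] m l by (meson le_trans)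
  qed
qed

lemma typed_fams_betas: "typed_fams \<Gamma> n T \<Longrightarrow> T \<rightarrow>\<^sub>\<beta>\<^sup>* T' \<Longrightarrow> typed_fams \<Gamma> n T'"
  by (rotate_tac, induct rule: rtranclp_induct) (auto intro: typed_fams_beta)

lemma typed_fams_weaken:
  assumes "typed_fams \<Gamma> n T" and A: "\<Gamma> \<tturnstile> A \<Colon> Cst t" "t \<in> sorts X"
  shows "typed_fams (A # \<Gamma>) n (lift T 0)"
  unfolding typed_fams_def
proof (intro conjI allI impI ballI)
  have d: "prd_depth m T" if "m \<le> n" for m
    using assms(1) that by (auto simp: typed_fams_def intro: prd_depth_mono)
  \<comment> \<open>Weakening in \<open>hjudg\<close> requires the kinds to be typed; this is the
    third clause of \<open>typed_fams\<close> at \<open>l = 0\<close>.\<close>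
  have k: "\<exists>s'\<in>sorts X. \<Gamma> \<tturnstile> kind m T s \<Colon> Cst s'" if "m \<le> n" "s \<in> sorts X" for m s
    using assms(1) that unfolding typed_fams_def by (metis fam_0 kind_0 le0)
  show "prd_depth n (lift T 0)" using d prd_depth_lift by blast
  show "\<exists>s\<in>sorts X. A # \<Gamma> \<tturnstile> fam m (lift T 0) \<Colon> kind m (lift T 0) s" if m: "m \<le> n" for m
  proof -
    obtain s where s: "s \<in> sorts X" "\<Gamma> \<tturnstile> fam m T \<Colon> kind m T s"
      using assms(1) m by (auto simp: typed_fams_def)
    then show ?thesis
      using k[OF m s(1)] A fam_lift[OF d[OF m]] kind_lift[OF d[OF m]] hjudg.weakening by metis
  qed
  show "\<exists>s'\<in>sorts X. A # \<Gamma> \<tturnstile> fam l (kind m (lift T 0) s) \<Colon> kind l (lift T 0) s'"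
    if m: "m \<le> n" and s: "s \<in> sorts X" and l: "l \<le> m" for m s l
  proof -
    obtain s' where s': "s' \<in> sorts X" "\<Gamma> \<tturnstile> fam l (kind m T s) \<Colon> kind l T s'"
      using assms(1) m s l unfolding typed_fams_def by blast
    have "fam l (kind m (lift T 0) s) = lift (fam l (kind m T s)) 0"
      using kind_lift[OF d[OF m]] fam_lift prd_depth_kind[OF d[OF m]] l prd_depth_mono by metis
    then show ?thesis
      using k[of l s'] s' A kind_lift[OF d[of l]] hjudg.weakening m l by (metis le_trans)
  qed
qed

section \<open>Applying combinators to their arguments\<close>

definition applicable :: "'c ctxt \<Rightarrow> nat \<Rightarrow> 'c trm \<Rightarrow> 'c trm \<Rightarrow> bool" where
  "applicable \<Gamma> n M T \<longleftrightarrow> \<Gamma> \<tturnstile> M \<Colon> T \<and> typed_fams \<Gamma> n T"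

text \<open>Closed terms are unchanged by weakening, so what holds in the empty context reaches
  every legal context, witnessed here by \<open>P\<close> and \<open>Q\<close>.\<close>

lemma applicable_closed:
  assumes "applicable [] n M T" and "lift M 0 = M" "lift T 0 = T" and "\<Gamma> \<tturnstile> P \<Colon> Q"
  shows "applicable \<Gamma> n M T"
  using assms(4)
proof (induct \<Gamma> arbitrary: P Q)
  case (Cons A \<Gamma>)
  then obtain t where t: "t \<in> sorts X" "\<Gamma> \<tturnstile> A \<Colon> Cst t" using hjudg_head_sort by blast
  have IH: "\<Gamma> \<tturnstile> M \<Colon> T" "typed_fams \<Gamma> n T" using Cons(1)[OF t(2)] by (auto simp: applicable_def)
  then obtain s where "s \<in> sorts X" "\<Gamma> \<tturnstile> T \<Colon> Cst s" unfolding typed_fams_def by (metis fam_0 kind_0 le0)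
  then show ?case
    using hjudg.weakening[OF IH(1) _ _ t(2,1)] typed_fams_weaken[OF IH(2) t(2,1)] assms(2,3)
    by (auto simp: applicable_def)
qed (rule assms(1))

text \<open>The application is contracted at once, ready for the next argument, and the families of
  the result are the old families applied to \<open>N\<close>. The annotation \<open>D'\<close> may
  differ from \<open>D\<close>, because \<open>applicable_reduce_domain\<close> reduces only the
  type.\<close>

lemma applicable_apply:
  assumes "applicable \<Gamma> (Suc n) (Abs D' M) (Prd D T)" and N: "\<Gamma> \<tturnstile> N \<Colon> D" "\<Gamma> \<tturnstile> D \<Colon> Cst s" "s \<in> sorts X"
  shows "applicable \<Gamma> n (subst M N 0) (subst T N 0)"
proof -
  have M: "\<Gamma> \<tturnstile> Abs D' M \<Colon> Prd D T" and fams: "typed_fams \<Gamma> (Suc n) (Prd D T)"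
    using assms(1) by (auto simp: applicable_def)
  then have d: "prd_depth m T" if "m \<le> n" for m
    using that by (auto simp: typed_fams_def intro: prd_depth_mono)
  have f: "\<exists>s\<in>sorts X. \<Gamma> \<tturnstile> fam m (Prd D T) \<Colon> kind m (Prd D T) s" if "m \<le> Suc n" for m
    using fams that by (auto simp: typed_fams_def)
  have k: "\<exists>s'\<in>sorts X. \<Gamma> \<tturnstile> fam l (kind m (Prd D T) s) \<Colon> kind l (Prd D T) s'"
    if "m \<le> Suc n" "s \<in> sorts X" "l \<le> m" for l m s
    using fams that by (auto simp: typed_fams_def)
  have kD: "\<exists>s'\<in>sorts X. \<Gamma> \<tturnstile> Prd D (Cst s) \<Colon> Cst s'" if "s \<in> sorts X" for s
    using k[of "Suc 0" s 0] that by auto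
  have app: "\<Gamma> \<tturnstile> subst Q N 0 \<Colon> subst P N 0"
    if "\<Gamma> \<tturnstile> Abs D'' Q \<Colon> Prd D P" "\<exists>s'\<in>sorts X. \<Gamma> \<tturnstile> Abs D P \<Colon> Prd D (Cst s')"
      "\<exists>s'\<in>sorts X. \<Gamma> \<tturnstile> Prd D P \<Colon> Cst s'" for D'' Q P
  proof -
    from that kD obtain s\<^sub>2 s\<^sub>3 s\<^sub>4 where "s\<^sub>2 \<in> sorts X" "s\<^sub>3 \<in> sorts X" "s\<^sub>4 \<in> sorts X"
      "\<Gamma> \<tturnstile> Abs D P \<Colon> Prd D (Cst s\<^sub>2)" "\<Gamma> \<tturnstile> Prd D P \<Colon> Cst s\<^sub>3" "\<Gamma> \<tturnstile> Prd D (Cst s\<^sub>2) \<Colon> Cst s\<^sub>4"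
      by blast
    then have "\<Gamma> \<tturnstile> App (Abs D'' Q) N \<Colon> subst P N 0"
      using hjudg.application that(1) N by blast
    then show ?thesis by (blast intro: hjudg.subject_reduction beta.redex)
  qed
  \<comment> \<open>The third clause at \<open>l = 1\<close> and \<open>l = 0\<close> types the
    family and the product that this application requires.\<close>
  have app_kind: "\<Gamma> \<tturnstile> subst Q N 0 \<Colon> subst (kind m T s) N 0"
    if "\<Gamma> \<tturnstile> Abs D Q \<Colon> Prd D (kind m T s)" "s \<in> sorts X" "m \<le> n" for Q m s
    using app[OF that(1)] k[of "Suc m" s "Suc 0"] k[of "Suc m" s 0] that by simp
  have "\<Gamma> \<tturnstile> subst M N 0 \<Colon> subst T N 0"
    using app[OF M] f[of 0] f[of "Suc 0"] by simp
  moreover have "typed_fams \<Gamma> n (subst T N 0)"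
    unfolding typed_fams_def
  proof (intro conjI allI impI ballI)
    show "prd_depth n (subst T N 0)" using d prd_depth_subst by blast
    show "\<exists>s\<in>sorts X. \<Gamma> \<tturnstile> fam m (subst T N 0) \<Colon> kind m (subst T N 0) s" if "m \<le> n" for m
      using f[of "Suc m"] app_kind that by (auto simp: fam_subst[OF d] kind_subst[OF d])
    show "\<exists>s'\<in>sorts X. \<Gamma> \<tturnstile> fam l (kind m (subst T N 0) s) \<Colon> kind l (subst T N 0) s'"
      if m: "m \<le> n" "s \<in> sorts X" "l \<le> m" for m s l
    proof -
      have "prd_depth l (kind m T s)" using prd_depth_kind[OF d] m prd_depth_mono by blast
      then show ?thesis
        using k[of "Suc m" s "Suc l"] app_kind[of _ l] m
        by (auto simp: fam_subst kind_subst[OF d])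
    qed
  qed
  ultimately show ?thesis by (simp add: applicable_def)
qed

text \<open>After a family has been substituted, the next domain contains redexes; it is reduced to
  the form at which the argument is typed.\<close>

lemma applicable_reduce_domain:
  "applicable \<Gamma> n M (Prd D T) \<Longrightarrow> D \<rightarrow>\<^sub>\<beta>\<^sup>* D' \<Longrightarrow> applicable \<Gamma> n M (Prd D' T)"
  using typed_fams_betas[OF _ betas_Prd] hjudg_reduce[OF _ _ betas_Prd] unfolding applicable_def by blast

end


section \<open>The combinators\<close>

context supersorted_pts
begin

definition wf_ctxt :: "'c ctxt \<Rightarrow> bool" where
  "wf_ctxt \<Gamma> \<longleftrightarrow> (\<exists>M B. \<Gamma> \<turnstile> M \<Colon> B)"

definition is_type :: "'c ctxt \<Rightarrow> 'c trm \<Rightarrow> bool" where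
  "is_type \<Gamma> A \<longleftrightarrow> (\<exists>s\<in>sorts X. \<Gamma> \<turnstile> A \<Colon> Cst s)"

lemma wf_ctxt_Nil: "wf_ctxt []"
  using ex_axiom judg.axiom unfolding wf_ctxt_def by blast

lemma wf_ctxt_Cons: "is_type \<Gamma> A \<Longrightarrow> wf_ctxt (A # \<Gamma>)"
  using judg.start unfolding wf_ctxt_def is_type_def by blast

lemma is_type_Cst: "wf_ctxt \<Gamma> \<Longrightarrow> is_type \<Gamma> (Cst c)"
  using ex_axiom judg_constant unfolding wf_ctxt_def is_type_def by blast

lemma is_type_Prd: "is_type (A # \<Gamma>) B \<Longrightarrow> is_type \<Gamma> (Prd A B)"
  using judg_head_sort ex_rule judg.product unfolding is_type_def by meson

lemma is_typeI: "\<Gamma> \<turnstile> A \<Colon> Cst s \<Longrightarrow> s \<in> sorts X \<Longrightarrow> is_type \<Gamma> A"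
  unfolding is_type_def by blast

lemma judg_Var: "wf_ctxt \<Gamma> \<Longrightarrow> i < length \<Gamma> \<Longrightarrow> lift0 (Suc i) (\<Gamma> ! i) = B \<Longrightarrow> \<Gamma> \<turnstile> Var i \<Colon> B"
proof (induct \<Gamma> arbitrary: i B)
  case (Cons A \<Gamma>)
  then obtain s where s: "s \<in> sorts X" "\<Gamma> \<turnstile> A \<Colon> Cst s"
    using judg_head_sort unfolding wf_ctxt_def by blast
  show ?case
  proof (cases i)
    case 0
    then show ?thesis using Cons(4) judg.start[OF s(2,1)] by simp
  next
    case (Suc i')
    then have "\<Gamma> \<turnstile> Var i' \<Colon> lift0 (Suc i') (\<Gamma> ! i')"
      using Cons s by (auto simp: wf_ctxt_def)
    from judg.weakening[OF this s(2,1)] show ?thesis using Suc Cons(4) by simp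
  qed
qed simp

lemma judg_App: "\<Gamma> \<turnstile> M \<Colon> Prd A B \<Longrightarrow> \<Gamma> \<turnstile> N \<Colon> A \<Longrightarrow> subst B N 0 = C \<Longrightarrow> \<Gamma> \<turnstile> App M N \<Colon> C"
  using derivable.application by (metis derivable_iff_judg)

text \<open>In a supersorted system every product of types is a type, so the second premise of
  abstraction is automatic.\<close>

lemma judg_Abs:
  assumes "A # \<Gamma> \<turnstile> M \<Colon> B"
  shows "\<Gamma> \<turnstile> Abs A M \<Colon> Prd A B"
proof -
  have "is_type \<Gamma> (Prd A B)"
    using judg_type_sort[OF assms] by (auto intro: is_type_Prd is_typeI)
  then show ?thesis using assms by (auto simp: is_type_def intro: judg.abstraction)
qed

section \<open>Typing the combinators in \<lambda>X\<close>

lemma judg_I1: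
  assumes "sort_valuation X \<sigma>"
  shows "[] \<turnstile> map_trm \<sigma> I1_tm \<Colon> map_trm \<sigma> I1_ty"
proof -
  let ?\<Gamma>\<^sub>1 = "[Cst (\<sigma> 1)]" let ?\<Gamma>\<^sub>2 = "Var 0 # ?\<Gamma>\<^sub>1"
  have 1: "wf_ctxt ?\<Gamma>\<^sub>1" by (intro wf_ctxt_Cons is_type_Cst wf_ctxt_Nil)
  have "?\<Gamma>\<^sub>1 \<turnstile> Var 0 \<Colon> Cst (\<sigma> 1)" using 1 by (rule judg_Var) simp_all
  then have 2: "wf_ctxt ?\<Gamma>\<^sub>2"
    using assms by (intro wf_ctxt_Cons) (auto intro: is_typeI simp: sort_valuation_def)
  then have "?\<Gamma>\<^sub>2 \<turnstile> Var 0 \<Colon> Var 1" by (rule judg_Var) simp_all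
  then show ?thesis
    by (auto simp: I1_tm_def I1_ty_def I1_tele_def intro!: judg_Abs)
qed

lemma judg_K1:
  assumes "sort_valuation X \<sigma>"
  shows "[] \<turnstile> map_trm \<sigma> K1_tm \<Colon> map_trm \<sigma> K1_ty"
proof -
  let ?\<Gamma>\<^sub>2 = "[Cst (\<sigma> 2), Cst (\<sigma> 1)]" let ?\<Gamma>\<^sub>3 = "Var 1 # ?\<Gamma>\<^sub>2" let ?\<Gamma>\<^sub>4 = "Var 1 # ?\<Gamma>\<^sub>3"
  have 2: "wf_ctxt ?\<Gamma>\<^sub>2" by (intro wf_ctxt_Cons is_type_Cst wf_ctxt_Nil)
  have "?\<Gamma>\<^sub>2 \<turnstile> Var 1 \<Colon> Cst (\<sigma> 1)" using 2 by (rule judg_Var) simp_all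
  then have 3: "wf_ctxt ?\<Gamma>\<^sub>3"
    using assms by (intro wf_ctxt_Cons) (auto intro: is_typeI simp: sort_valuation_def)
  then have "?\<Gamma>\<^sub>3 \<turnstile> Var 1 \<Colon> Cst (\<sigma> 2)" by (rule judg_Var) simp_all
  then have 4: "wf_ctxt ?\<Gamma>\<^sub>4"
    using assms by (intro wf_ctxt_Cons) (auto intro: is_typeI simp: sort_valuation_def)
  then have "?\<Gamma>\<^sub>4 \<turnstile> Var 1 \<Colon> Var 3" by (rule judg_Var) (simp_all add: numeral_eq_Suc)
  then show ?thesis
    by (auto simp: K1_tm_def K1_ty_def K1_tele_def intro!: judg_Abs)
qed

lemma judg_Pi1:
  assumes "sort_valuation X \<sigma>" and r: "(\<sigma> 1, \<sigma> 2, \<sigma> 3) \<in> rules X"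
  shows "[] \<turnstile> map_trm \<sigma> Pi1_tm \<Colon> map_trm \<sigma> Pi1_ty"
proof -
  let ?\<Gamma>\<^sub>1 = "[Cst (\<sigma> 1)]" let ?\<Gamma>\<^sub>2 = "Prd (Var 0) (Cst (\<sigma> 2)) # ?\<Gamma>\<^sub>1" let ?\<Gamma>\<^sub>3 = "Var 1 # ?\<Gamma>\<^sub>2"
  have 1: "wf_ctxt ?\<Gamma>\<^sub>1" by (intro wf_ctxt_Cons is_type_Cst wf_ctxt_Nil)
  have "?\<Gamma>\<^sub>1 \<turnstile> Var 0 \<Colon> Cst (\<sigma> 1)" using 1 by (rule judg_Var) simp_all
  then have "wf_ctxt (Var 0 # ?\<Gamma>\<^sub>1)"
    using assms by (intro wf_ctxt_Cons) (auto intro: is_typeI simp: sort_valuation_def)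
  then have 2: "wf_ctxt ?\<Gamma>\<^sub>2" by (rule wf_ctxt_Cons[OF is_type_Prd[OF is_type_Cst]])
  have u: "?\<Gamma>\<^sub>2 \<turnstile> Var 1 \<Colon> Cst (\<sigma> 1)" using 2 by (rule judg_Var) simp_all
  then have 3: "wf_ctxt ?\<Gamma>\<^sub>3"
    using assms by (intro wf_ctxt_Cons) (auto intro: is_typeI simp: sort_valuation_def)
  have "?\<Gamma>\<^sub>3 \<turnstile> App (Var 1) (Var 0) \<Colon> Cst (\<sigma> 2)"
    by (rule judg_App[OF judg_Var[OF 3, of _ "Prd (Var 2) (Cst (\<sigma> 2))"] judg_Var[OF 3]])
      (simp_all add: numeral_eq_Suc)
  from judg.product[OF this u r] show ?thesis
    by (auto simp: Pi1_tm_def Pi1_ty_def Pi1_tele_def intro!: judg_Abs)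
qed

lemma judg_S1:
  assumes "sort_valuation X \<sigma>"
  shows "[] \<turnstile> map_trm \<sigma> S1_tm \<Colon> map_trm \<sigma> S1_ty"
proof -
  have \<sigma>: "\<sigma> i \<in> sorts X" for i using assms by (simp add: sort_valuation_def)
  let ?u = "Cst (\<sigma> 1)" and ?v = "Prd (Var 0) (Cst (\<sigma> 2))"
    and ?t = "Prd (Var 1) (Prd (App (Var 1) (Var 0)) (Cst (\<sigma> 3)))"
    and ?w = "Prd (Var 2) (Prd (App (Var 2) (Var 0)) (App (App (Var 2) (Var 1)) (Var 0)))"
    and ?z = "Prd (Var 3) (App (Var 3) (Var 0))" and ?x = "Var 4 :: 'c trm"
  \<comment> \<open>The context is built one declaration at a time. For each product type its bound
    variables are declared temporarily to type the body, and \<open>is_type_Prd\<close> discharges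
    them.\<close>
  have 1: "wf_ctxt [?u]" by (intro wf_ctxt_Cons is_type_Cst wf_ctxt_Nil)
  have "[?u] \<turnstile> Var 0 \<Colon> Cst (\<sigma> 1)" using 1 by (rule judg_Var) simp_all
  then have "wf_ctxt [Var 0, ?u]" using \<sigma> by (intro wf_ctxt_Cons) (auto intro: is_typeI)
  then have 2: "wf_ctxt [?v, ?u]" by (rule wf_ctxt_Cons[OF is_type_Prd[OF is_type_Cst]])
  have "[?v, ?u] \<turnstile> Var 1 \<Colon> Cst (\<sigma> 1)" using 2 by (rule judg_Var) simp_all
  then have w: "wf_ctxt [Var 1, ?v, ?u]" using \<sigma> by (intro wf_ctxt_Cons) (auto intro: is_typeI)
  have "[Var 1, ?v, ?u] \<turnstile> App (Var 1) (Var 0) \<Colon> Cst (\<sigma> 2)"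
    by (rule judg_App[OF judg_Var[OF w, of _ "Prd (Var 2) (Cst (\<sigma> 2))"] judg_Var[OF w]])
      (simp_all add: numeral_eq_Suc)
  then have "wf_ctxt [App (Var 1) (Var 0), Var 1, ?v, ?u]"
    using \<sigma> by (intro wf_ctxt_Cons) (auto intro: is_typeI)
  then have 3: "wf_ctxt [?t, ?v, ?u]"
    by (rule wf_ctxt_Cons[OF is_type_Prd[OF is_type_Prd[OF is_type_Cst]]])
  have "[?t, ?v, ?u] \<turnstile> Var 2 \<Colon> Cst (\<sigma> 1)" using 3 by (rule judg_Var) (simp_all add: numeral_eq_Suc)
  then have w: "wf_ctxt [Var 2, ?t, ?v, ?u]" using \<sigma> by (intro wf_ctxt_Cons) (auto intro: is_typeI)
  have "[Var 2, ?t, ?v, ?u] \<turnstile> App (Var 2) (Var 0) \<Colon> Cst (\<sigma> 2)"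
    by (rule judg_App[OF judg_Var[OF w, of _ "Prd (Var 3) (Cst (\<sigma> 2))"] judg_Var[OF w]])
      (simp_all add: numeral_eq_Suc)
  then have w: "wf_ctxt [App (Var 2) (Var 0), Var 2, ?t, ?v, ?u]"
    using \<sigma> by (intro wf_ctxt_Cons) (auto intro: is_typeI)
  have "[App (Var 2) (Var 0), Var 2, ?t, ?v, ?u] \<turnstile> App (App (Var 2) (Var 1)) (Var 0) \<Colon> Cst (\<sigma> 3)"
    by (rule judg_App[OF judg_App[OF judg_Var[OF w, of _
            "Prd (Var 4) (Prd (App (Var 4) (Var 0)) (Cst (\<sigma> 3)))"] judg_Var[OF w],
          where C = "Prd (App (Var 3) (Var 1)) (Cst (\<sigma> 3))"] judg_Var[OF w]])
      (simp_all add: numeral_eq_Suc)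
  then have 4: "wf_ctxt [?w, ?t, ?v, ?u]"
    using \<sigma> by (intro wf_ctxt_Cons is_type_Prd) (auto intro: is_typeI)
  have "[?w, ?t, ?v, ?u] \<turnstile> Var 3 \<Colon> Cst (\<sigma> 1)"
    using 4 by (rule judg_Var) (simp_all add: numeral_eq_Suc)
  then have w: "wf_ctxt [Var 3, ?w, ?t, ?v, ?u]"
    using \<sigma> by (intro wf_ctxt_Cons) (auto intro: is_typeI)
  have "[Var 3, ?w, ?t, ?v, ?u] \<turnstile> App (Var 3) (Var 0) \<Colon> Cst (\<sigma> 2)"
    by (rule judg_App[OF judg_Var[OF w, of _ "Prd (Var 4) (Cst (\<sigma> 2))"] judg_Var[OF w]])
      (simp_all add: numeral_eq_Suc)
  then have 5: "wf_ctxt [?z, ?w, ?t, ?v, ?u]"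
    using \<sigma> by (intro wf_ctxt_Cons is_type_Prd) (auto intro: is_typeI)
  have "[?z, ?w, ?t, ?v, ?u] \<turnstile> Var 4 \<Colon> Cst (\<sigma> 1)"
    using 5 by (rule judg_Var) (simp_all add: numeral_eq_Suc)
  then have w: "wf_ctxt [?x, ?z, ?w, ?t, ?v, ?u]"
    using \<sigma> by (intro wf_ctxt_Cons) (auto intro: is_typeI)
  have zx: "[?x, ?z, ?w, ?t, ?v, ?u] \<turnstile> App (Var 1) (Var 0) \<Colon> App (Var 4) (Var 0)"
    by (rule judg_App[OF judg_Var[OF w, of _ "Prd (Var 5) (App (Var 5) (Var 0))"] judg_Var[OF w]])
      (simp_all add: numeral_eq_Suc)
  have "[?x, ?z, ?w, ?t, ?v, ?u] \<turnstile> App (App (Var 2) (Var 0)) (App (Var 1) (Var 0))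
      \<Colon> App (App (Var 3) (Var 0)) (App (Var 1) (Var 0))"
    by (rule judg_App[OF judg_App[OF judg_Var[OF w, of _
            "Prd (Var 5) (Prd (App (Var 5) (Var 0)) (App (App (Var 5) (Var 1)) (Var 0)))"] judg_Var[OF w],
          where C = "Prd (App (Var 4) (Var 0)) (App (App (Var 4) (Var 1)) (Var 0))"] zx])
      (simp_all add: numeral_eq_Suc)
  then show ?thesis
    by (auto simp: S1_tm_def S1_ty_def S1_tele_def intro!: judg_Abs)
qed

text \<open>The axiom types the combinator, \<open>typed_fams_scheme\<close> its families, and
  closedness carries both into \<open>\<Gamma>\<close>.\<close>

lemma applicable_scheme:
  assumes "scheme X M T" "prd_depth n T" "0 < n" "sort_valuation X \<sigma>"
    and "[] \<turnstile> map_trm \<sigma> M \<Colon> map_trm \<sigma> T" and "M = Pi1_tm \<and> T = Pi1_ty \<Longrightarrow> (\<sigma> 1, \<sigma> 2, \<sigma> 3) \<in> rules X"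
    and "lift (map_trm \<sigma> M) 0 = map_trm \<sigma> M" "lift (map_trm \<sigma> T) 0 = map_trm \<sigma> T" and "\<Gamma> \<tturnstile> P \<Colon> Q"
  shows "applicable \<Gamma> n (map_trm \<sigma> M) (map_trm \<sigma> T)"
proof (rule applicable_closed[OF _ assms(7-9)])
  have "hilbert_axiom X (map_trm \<sigma> M) (map_trm \<sigma> T)"
    unfolding hilbert_axiom_def derivable_instance_def derivable_iff_judg using assms by blast
  moreover obtain s where "s \<in> sorts X" "[] \<turnstile> map_trm \<sigma> T \<Colon> Cst s"
    using judg_type_sort assms(5) by blast
  ultimately show "applicable [] n (map_trm \<sigma> M) (map_trm \<sigma> T)"
    unfolding applicable_def using typed_fams_scheme[OF assms(1-4)] by (blast intro: hjudg.hilbert)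
qed

text \<open>Every remaining index is sent to \<open>s\<^sub>3\<close>, as
  \<open>sort_valuation\<close> asks for a sort everywhere.\<close>

definition valuation3 :: "'c \<Rightarrow> 'c \<Rightarrow> 'c \<Rightarrow> nat \<Rightarrow> 'c" where
  "valuation3 s\<^sub>1 s\<^sub>2 s\<^sub>3 i = (if i = 1 then s\<^sub>1 else if i = 2 then s\<^sub>2 else s\<^sub>3)"

lemma valuation3_simps [simp]:
  "valuation3 s\<^sub>1 s\<^sub>2 s\<^sub>3 1 = s\<^sub>1" "valuation3 s\<^sub>1 s\<^sub>2 s\<^sub>3 (Suc 0) = s\<^sub>1"
  "valuation3 s\<^sub>1 s\<^sub>2 s\<^sub>3 2 = s\<^sub>2" "valuation3 s\<^sub>1 s\<^sub>2 s\<^sub>3 (Suc (Suc 0)) = s\<^sub>2" "valuation3 s\<^sub>1 s\<^sub>2 s\<^sub>3 3 = s\<^sub>3"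
  by (simp_all add: valuation3_def)

lemma sort_valuation3:
  "s\<^sub>1 \<in> sorts X \<Longrightarrow> s\<^sub>2 \<in> sorts X \<Longrightarrow> s\<^sub>3 \<in> sorts X \<Longrightarrow> sort_valuation X (valuation3 s\<^sub>1 s\<^sub>2 s\<^sub>3)"
  by (simp add: sort_valuation_def valuation3_def)

section \<open>Applicable instances of the combinators\<close>

lemma applicable_I1:
  assumes "s\<^sub>1 \<in> sorts X" and "\<Gamma> \<tturnstile> P \<Colon> Q"
  shows "applicable \<Gamma> 2 (Abs (Cst s\<^sub>1) (Abs (Var 0) (Var 0))) (Prd (Cst s\<^sub>1) (Prd (Var 0) (Var 1)))"
  using applicable_scheme[OF scheme.I1, of 2 "valuation3 s\<^sub>1 s\<^sub>1 s\<^sub>1" \<Gamma> P Q]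
    judg_I1[of "valuation3 s\<^sub>1 s\<^sub>1 s\<^sub>1"] sort_valuation3[of s\<^sub>1 s\<^sub>1 s\<^sub>1] assms
  by (simp add: I1_tm_def I1_ty_def I1_tele_def Pi1_tm_def Pi1_tele_def numeral_eq_Suc)

lemma applicable_K1:
  assumes "s\<^sub>1 \<in> sorts X" "s\<^sub>2 \<in> sorts X" and "\<Gamma> \<tturnstile> P \<Colon> Q"
  shows "applicable \<Gamma> 3 (Abs (Cst s\<^sub>1) (Abs (Cst s\<^sub>2) (Abs (Var 1) (Abs (Var 1) (Var 1)))))
    (Prd (Cst s\<^sub>1) (Prd (Cst s\<^sub>2) (Prd (Var 1) (Prd (Var 1) (Var 3)))))"
  using applicable_scheme[OF scheme.K1, of 3 "valuation3 s\<^sub>1 s\<^sub>2 s\<^sub>1" \<Gamma> P Q]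
    judg_K1[of "valuation3 s\<^sub>1 s\<^sub>2 s\<^sub>1"] sort_valuation3[of s\<^sub>1 s\<^sub>2 s\<^sub>1] assms
  by (simp add: K1_tm_def K1_ty_def K1_tele_def Pi1_tm_def Pi1_tele_def numeral_3_eq_3)

lemma applicable_Pi1:
  assumes "(s\<^sub>1, s\<^sub>2, s\<^sub>3) \<in> rules X" and "\<Gamma> \<tturnstile> P \<Colon> Q"
  shows "applicable \<Gamma> 2 (Abs (Cst s\<^sub>1) (Abs (Prd (Var 0) (Cst s\<^sub>2)) (Prd (Var 1) (App (Var 1) (Var 0)))))
    (Prd (Cst s\<^sub>1) (Prd (Prd (Var 0) (Cst s\<^sub>2)) (Cst s\<^sub>3)))"
  using applicable_scheme[OF scheme.Pi1, of 2 "valuation3 s\<^sub>1 s\<^sub>2 s\<^sub>3" \<Gamma> P Q]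
    judg_Pi1[of "valuation3 s\<^sub>1 s\<^sub>2 s\<^sub>3"] sort_valuation3[of s\<^sub>1 s\<^sub>2 s\<^sub>3] assms rule_sorts[OF assms(1)]
  by (simp add: Pi1_tm_def Pi1_ty_def Pi1_tele_def numeral_2_eq_2)

text \<open>Depth 5 allows the arguments for \<open>u\<close>, \<open>v\<close>, \<open>t\<close>,
  \<open>w\<close>, \<open>z\<close>; the remaining product over \<open>x\<close> is the type that
  \<open>hjudg_S\<close> delivers.\<close>

lemma applicable_S1:
  assumes "s\<^sub>1 \<in> sorts X" "s\<^sub>2 \<in> sorts X" "s\<^sub>3 \<in> sorts X" and "\<Gamma> \<tturnstile> P \<Colon> Q"
  shows "applicable \<Gamma> 5
    (Abs (Cst s\<^sub>1) (Abs (Prd (Var 0) (Cst s\<^sub>2)) (Abs (Prd (Var 1) (Prd (App (Var 1) (Var 0)) (Cst s\<^sub>3)))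
      (Abs (Prd (Var 2) (Prd (App (Var 2) (Var 0)) (App (App (Var 2) (Var 1)) (Var 0))))
      (Abs (Prd (Var 3) (App (Var 3) (Var 0)))
      (Abs (Var 4) (App (App (Var 2) (Var 0)) (App (Var 1) (Var 0)))))))))
    (Prd (Cst s\<^sub>1) (Prd (Prd (Var 0) (Cst s\<^sub>2)) (Prd (Prd (Var 1) (Prd (App (Var 1) (Var 0)) (Cst s\<^sub>3)))
      (Prd (Prd (Var 2) (Prd (App (Var 2) (Var 0)) (App (App (Var 2) (Var 1)) (Var 0))))
      (Prd (Prd (Var 3) (App (Var 3) (Var 0)))
      (Prd (Var 4) (App (App (Var 3) (Var 0)) (App (Var 1) (Var 0)))))))))"
proof -
  have "prd_depth 5 S1_ty"
    by (simp add: S1_ty_def S1_tele_def numeral_eq_Suc)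
  then show ?thesis
    using applicable_scheme[OF scheme.S1, of 5 "valuation3 s\<^sub>1 s\<^sub>2 s\<^sub>3" \<Gamma> P Q]
      judg_S1[of "valuation3 s\<^sub>1 s\<^sub>2 s\<^sub>3"] sort_valuation3[of s\<^sub>1 s\<^sub>2 s\<^sub>3] assms
    by (simp add: S1_tm_def S1_ty_def S1_tele_def Pi1_tm_def Pi1_tele_def)
qed

section \<open>Derived rules from the combinators\<close>

lemma subst_lift_0 [simp]: "subst (lift t 0) (lift u 0) (Suc k) = lift (subst t u k) 0"
  by (simp add: lift_subst_lt)

text \<open>\<open>I1\<close> applied to \<open>A\<close> leaves one product with domain
  \<open>A\<close>. Its typed families also yield a sort for \<open>Prd A (Cst s')\<close>, before
  any product rule is available.\<close>

lemma hjudg_identity: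
  assumes "\<Gamma> \<tturnstile> A \<Colon> Cst s" "s \<in> sorts X"
  shows "\<Gamma> \<tturnstile> Abs A (Var 0) \<Colon> Prd A (lift A 0)"
    and "s' \<in> sorts X \<Longrightarrow> \<exists>s''\<in>sorts X. \<Gamma> \<tturnstile> Prd A (Cst s') \<Colon> Cst s''"
proof -
  obtain t where "t \<in> sorts X" "\<Gamma> \<tturnstile> Cst s \<Colon> Cst t" using hjudg_constant_sort assms(1) by blast
  from applicable_apply[OF applicable_I1[OF assms(2,1), unfolded numeral_2_eq_2] assms(1) this(2,1)]
  have *: "applicable \<Gamma> (Suc 0) (Abs A (Var 0)) (Prd A (lift A 0))" by simp
  then show "\<Gamma> \<tturnstile> Abs A (Var 0) \<Colon> Prd A (lift A 0)" by (simp add: applicable_def)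
  assume "s' \<in> sorts X"
  then have "\<exists>s''\<in>sorts X. \<Gamma> \<tturnstile> fam 0 (kind (Suc 0) (Prd A (lift A 0)) s') \<Colon> kind 0 (Prd A (lift A 0)) s''"
    using * unfolding applicable_def typed_fams_def by blast
  then show "\<exists>s''\<in>sorts X. \<Gamma> \<tturnstile> Prd A (Cst s') \<Colon> Cst s''" by simp
qed

text \<open>\<open>K1\<close> applied to \<open>B\<close>, \<open>A\<close> and
  \<open>M\<close>.\<close>

lemma hjudg_const_fun:
  assumes M: "\<Gamma> \<tturnstile> M \<Colon> B" and B: "\<Gamma> \<tturnstile> B \<Colon> Cst s\<^sub>1" "s\<^sub>1 \<in> sorts X" and A: "\<Gamma> \<tturnstile> A \<Colon> Cst s\<^sub>2" "s\<^sub>2 \<in> sorts X"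
  shows "\<Gamma> \<tturnstile> Abs A (lift M 0) \<Colon> Prd A (lift B 0)"
proof -
  obtain t\<^sub>1 where t1: "t\<^sub>1 \<in> sorts X" "\<Gamma> \<tturnstile> Cst s\<^sub>1 \<Colon> Cst t\<^sub>1" using hjudg_constant_sort M by blast
  obtain t\<^sub>2 where t2: "t\<^sub>2 \<in> sorts X" "\<Gamma> \<tturnstile> Cst s\<^sub>2 \<Colon> Cst t\<^sub>2" using hjudg_constant_sort M by blast
  note h1 = applicable_apply[OF applicable_K1[OF B(2) A(2) M, unfolded numeral_3_eq_3] B(1) t1(2,1),
      simplified]
  note h2 = applicable_apply[OF h1 A(1) t2(2,1), simplified]
  note h3 = applicable_apply[OF h2 M B, simplified]
  show ?thesis using h3 by (simp add: applicable_def numeral_3_eq_3 subst_lift_0)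
qed

text \<open>\<open>Pi1\<close> takes the codomain as a family on \<open>A\<close>, so the
  abstraction of \<open>B\<close> has to be typed first. The type of that family is typed by
  \<open>hjudg_identity\<close>.\<close>

lemma hjudg_product:
  assumes A: "\<Gamma> \<tturnstile> A \<Colon> Cst s\<^sub>1" and B: "\<Gamma> \<tturnstile> Abs A B \<Colon> Prd A (Cst s\<^sub>2)" and r: "(s\<^sub>1, s\<^sub>2, s\<^sub>3) \<in> rules X"
  shows "\<Gamma> \<tturnstile> Prd A B \<Colon> Cst s\<^sub>3"
proof -
  have s: "s\<^sub>1 \<in> sorts X" "s\<^sub>2 \<in> sorts X" using rule_sorts[OF r] by auto
  obtain t\<^sub>1 where t1: "t\<^sub>1 \<in> sorts X" "\<Gamma> \<tturnstile> Cst s\<^sub>1 \<Colon> Cst t\<^sub>1" using hjudg_constant_sort A by blast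
  obtain t\<^sub>2 where t2: "t\<^sub>2 \<in> sorts X" "\<Gamma> \<tturnstile> Prd A (Cst s\<^sub>2) \<Colon> Cst t\<^sub>2"
    using hjudg_identity(2)[OF A s] by blast
  note h1 = applicable_apply[OF applicable_Pi1[OF r A, unfolded numeral_2_eq_2] A t1(2,1), simplified]
  note h2 = applicable_apply[OF h1 B t2(2,1)]
  have "\<Gamma> \<tturnstile> Prd A (App (lift (Abs A B) 0) (Var 0)) \<Colon> Cst s\<^sub>3"
    using h2 by (simp add: applicable_def subst_lift_0)
  moreover have "App (lift (Abs A B) 0) (Var 0) \<rightarrow>\<^sub>\<beta>\<^sup>* B"
    by (rule betas_redex) auto
  ultimately show ?thesis
    by (auto intro: hjudg_reduce betas_Prd)
qed

text \<open>The arguments of \<open>S1\<close> are \<open>A\<close>, \<open>V\<close>,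
  \<open>T\<close>, \<open>W\<close>, \<open>Z\<close>. The domains expected for the last three
  contain applied families, so each comes with a reduct \<open>P\<close>, \<open>Q\<close> or
  \<open>R\<close> at which it is typed.\<close>

lemma hjudg_S:
  assumes A: "\<Gamma> \<tturnstile> A \<Colon> Cst s\<^sub>1" "s\<^sub>1 \<in> sorts X"
    and V: "\<Gamma> \<tturnstile> V \<Colon> Prd A (Cst s\<^sub>2)" "s\<^sub>2 \<in> sorts X"
    and T: "\<Gamma> \<tturnstile> T \<Colon> P" "\<Gamma> \<tturnstile> P \<Colon> Cst t\<^sub>1" "t\<^sub>1 \<in> sorts X" "s\<^sub>3 \<in> sorts X"
      "Prd A (Prd (App (lift V 0) (Var 0)) (Cst s\<^sub>3)) \<rightarrow>\<^sub>\<beta>\<^sup>* P"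
    and W: "\<Gamma> \<tturnstile> W \<Colon> Q" "\<Gamma> \<tturnstile> Q \<Colon> Cst t\<^sub>2" "t\<^sub>2 \<in> sorts X"
      "Prd A (Prd (App (lift V 0) (Var 0)) (App (App (lift (lift T 0) 0) (Var 1)) (Var 0))) \<rightarrow>\<^sub>\<beta>\<^sup>* Q"
    and Z: "\<Gamma> \<tturnstile> Z \<Colon> R" "\<Gamma> \<tturnstile> R \<Colon> Cst t\<^sub>3" "t\<^sub>3 \<in> sorts X" "Prd A (App (lift V 0) (Var 0)) \<rightarrow>\<^sub>\<beta>\<^sup>* R"
  shows "\<Gamma> \<tturnstile> Abs A (App (App (lift W 0) (Var 0)) (App (lift Z 0) (Var 0))) \<Colon>
    Prd A (App (App (lift T 0) (Var 0)) (App (lift Z 0) (Var 0)))"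
proof -
  obtain r\<^sub>1 where r1: "r\<^sub>1 \<in> sorts X" "\<Gamma> \<tturnstile> Cst s\<^sub>1 \<Colon> Cst r\<^sub>1" using hjudg_constant_sort A by blast
  obtain r\<^sub>2 where r2: "r\<^sub>2 \<in> sorts X" "\<Gamma> \<tturnstile> Prd A (Cst s\<^sub>2) \<Colon> Cst r\<^sub>2"
    using hjudg_identity(2)[OF A V(2)] by blast
  have five: "5 = Suc (Suc (Suc (Suc (Suc 0))))" by simp
  note h0 = applicable_S1[OF A(2) V(2) T(4) A(1), unfolded five]
  note h1 = applicable_apply[OF h0 A(1) r1(2,1), simplified]
  note h2 = applicable_apply[OF h1 V(1) r2(2,1), simplified]
  note h3 = applicable_apply[OF applicable_reduce_domain[OF h2 T(5)] T(1-3), simplified]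
  note h4 = applicable_apply[OF applicable_reduce_domain[OF h3 W(4)[simplified]] W(1-3), simplified]
  note h5 = applicable_apply[OF applicable_reduce_domain[OF h4 Z(4)] Z(1-3), simplified]
  show ?thesis using h5 by (simp add: applicable_def)
qed

section \<open>Abstraction in the Hilbert-style system\<close>

lemma hjudg_abstraction:
  assumes "A # \<Gamma> \<tturnstile> M \<Colon> B"
  shows "\<Gamma> \<tturnstile> Abs A M \<Colon> Prd A B"
  using assms
proof (induct "A # \<Gamma>" M B)
  case (start s)
  then show ?case by (blast intro: hjudg_identity)
next
  case (weakening M B s' s)
  then show ?case by (blast intro: hjudg_const_fun)
next
  case (application M C D N s\<^sub>2 s\<^sub>3 s\<^sub>4 s\<^sub>5)
  obtain s\<^sub>1 where A: "s\<^sub>1 \<in> sorts X" "\<Gamma> \<tturnstile> A \<Colon> Cst s\<^sub>1"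
    using hjudg_head_sort application(1) by blast
  have prod: "\<exists>s\<in>sorts X. \<Gamma> \<tturnstile> Prd A E \<Colon> Cst s" if "\<Gamma> \<tturnstile> Abs A E \<Colon> Prd A (Cst s')" "s' \<in> sorts X" for E s'
    using that ex_rule[OF A(1) that(2)] hjudg_product[OF A(2)] by blast
  \<comment> \<open>The induction hypotheses for the extra premises of application give families
    over \<open>A\<close>; \<open>prod\<close> makes products of them, which are the reduced domains
    of the last three arguments of \<open>S1\<close>.\<close>
  obtain t\<^sub>1 t\<^sub>2 t\<^sub>3 where t: "t\<^sub>1 \<in> sorts X" "\<Gamma> \<tturnstile> Prd A (Prd C (Cst s\<^sub>3)) \<Colon> Cst t\<^sub>1"
    "t\<^sub>2 \<in> sorts X" "\<Gamma> \<tturnstile> Prd A (Prd C D) \<Colon> Cst t\<^sub>2" "t\<^sub>3 \<in> sorts X" "\<Gamma> \<tturnstile> Prd A C \<Colon> Cst t\<^sub>3"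
    using prod application by meson
  have beta_Abs: "App (lift (Abs A E) 0) (Var 0) \<rightarrow>\<^sub>\<beta>\<^sup>* E" for E
    by (rule betas_redex) auto
  have V: "App (lift (Abs A C) 0) (Var 0) \<rightarrow>\<^sub>\<beta>\<^sup>* C"
    and W: "App (lift (Abs A M) 0) (Var 0) \<rightarrow>\<^sub>\<beta>\<^sup>* M"
    and Z: "App (lift (Abs A N) 0) (Var 0) \<rightarrow>\<^sub>\<beta>\<^sup>* N"
    by (rule beta_Abs)+
  \<comment> \<open>The nested family is applied to \<open>x\<close> and \<open>y\<close>, which
    have the indices 1 and 0 under both binders.\<close>
  have "App (lift (lift (Abs A (Abs C D)) 0) 0) (Var 1) \<rightarrow>\<^sub>\<beta>\<^sup>* Abs (lift C 0) (lift D 1)"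
    by (rule betas_redex) auto
  then have T: "App (App (lift (lift (Abs A (Abs C D)) 0) 0) (Var 1)) (Var 0) \<rightarrow>\<^sub>\<beta>\<^sup>* D"
    by (rule betas_redex) simp
  have "App (App (lift (Abs A (Abs C D)) 0) (Var 0)) N \<rightarrow>\<^sub>\<beta>\<^sup>* subst D N 0"
    by (rule betas_redex[OF beta_Abs]) simp
  then have res: "App (App (lift (Abs A (Abs C D)) 0) (Var 0)) (App (lift (Abs A N) 0) (Var 0))
      \<rightarrow>\<^sub>\<beta>\<^sup>* subst D N 0"
    using betas_App[OF rtranclp.rtrancl_refl Z] by (rule rtranclp_trans[rotated])
  \<comment> \<open>\<open>S1\<close> receives the abstractions over \<open>A\<close> of
    \<open>C\<close>, \<open>Abs C D\<close>, \<open>M\<close> and \<open>N\<close>. Contracting the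
    remaining redexes then gives \<open>Abs A (App M N)\<close> and its type.\<close>
  have "\<Gamma> \<tturnstile> Abs A (App (App (lift (Abs A M) 0) (Var 0)) (App (lift (Abs A N) 0) (Var 0))) \<Colon>
      Prd A (App (App (lift (Abs A (Abs C D)) 0) (Var 0)) (App (lift (Abs A N) 0) (Var 0)))"
    using application t A V W Z T
    by (intro hjudg_S[where V = "Abs A C" and s\<^sub>1 = s\<^sub>1 and s\<^sub>2 = s\<^sub>2 and s\<^sub>3 = s\<^sub>3 and P = "Prd A (Prd C (Cst s\<^sub>3))"
        and Q = "Prd A (Prd C D)" and R = "Prd A C" and t\<^sub>1 = t\<^sub>1 and t\<^sub>2 = t\<^sub>2 and t\<^sub>3 = t\<^sub>3]
        betas_Prd rtranclp.rtrancl_refl) assumption+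
  then show ?case
    by (rule hjudg_reduce) (intro betas_Abs betas_Prd betas_App W Z res rtranclp.rtrancl_refl)+
next
  case (conversion M B B' s)
  obtain s\<^sub>1 where A: "s\<^sub>1 \<in> sorts X" "\<Gamma> \<tturnstile> A \<Colon> Cst s\<^sub>1"
    using hjudg_head_sort conversion(1) by blast
  \<comment> \<open>Conversion needs its target typed: the induction hypothesis for
    \<open>B'\<close> gives a family, and supersortedness a rule.\<close>
  then obtain s\<^sub>3 where "s\<^sub>3 \<in> sorts X" "\<Gamma> \<tturnstile> Prd A B' \<Colon> Cst s\<^sub>3"
    using ex_rule[OF A(1) conversion(5)] hjudg_product[OF A(2)] conversion(4) by blast
  moreover have "Prd A B =\<^sub>\<beta> Prd A B'"
    using conversion(6) by (rule equivclp_map[of beta beta "Prd A", rotated]) (rule beta.PrdR)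
  ultimately show ?case using conversion(2) by (blast intro: hjudg.conversion)
next
  case (type_reduction M B B')
  then show ?case by (blast intro: hjudg.type_reduction beta.PrdR)
next
  case (subject_reduction M B M')
  then show ?case by (blast intro: hjudg.subject_reduction beta.AbsR)
qed

text \<open>The sort of \<open>A\<close> is carried along because weakening in \<open>hjudg\<close>
  requires the type of the subject to be typed.\<close>

lemma judg_imp_hjudg:
  assumes "\<Gamma> \<turnstile> M \<Colon> A"
  shows "\<Gamma> \<tturnstile> M \<Colon> A \<and> (\<exists>s\<in>sorts X. \<Gamma> \<tturnstile> A \<Colon> Cst s)"
  using assms
proof induct
  case (axiom c s)
  then show ?case using hjudg_constant_sort by (blast intro: hjudg.axiom)
next
  case (start \<Gamma> A s)
  then obtain s' where "s' \<in> sorts X" "\<Gamma> \<tturnstile> Cst s \<Colon> Cst s'" by blast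
  then show ?case
    using start hjudg.start[of \<Gamma> A s] hjudg.weakening[of \<Gamma> A "Cst s" s' A s] by auto
next
  case (weakening \<Gamma> M B A s)
  then obtain s\<^sub>1 where B: "s\<^sub>1 \<in> sorts X" "\<Gamma> \<tturnstile> B \<Colon> Cst s\<^sub>1" by blast
  then obtain s\<^sub>2 where "s\<^sub>2 \<in> sorts X" "\<Gamma> \<tturnstile> Cst s\<^sub>1 \<Colon> Cst s\<^sub>2" using hjudg_constant_sort by blast
  then show ?case
    using B weakening hjudg.weakening[of \<Gamma> M B s\<^sub>1 A s] hjudg.weakening[of \<Gamma> B "Cst s\<^sub>1" s\<^sub>2 A s]
    by auto
next
  case (application \<Gamma> M A B N s\<^sub>1 s\<^sub>2)
  \<comment> \<open>Stated for general \<open>P\<close> and \<open>C\<close>, as it serves twice: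
    for \<open>App M N\<close>, and for \<open>App (Abs A B) N\<close>, whose contraction types
    \<open>subst B N 0\<close>.\<close>
  have app: "\<Gamma> \<tturnstile> App P N \<Colon> subst C N 0"
    if P: "\<Gamma> \<tturnstile> P \<Colon> Prd A C" and C: "A # \<Gamma> \<tturnstile> C \<Colon> Cst s" "s \<in> sorts X" for P C s
  proof -
    obtain s' where "s' \<in> sorts X" "A # \<Gamma> \<tturnstile> Cst s \<Colon> Cst s'"
      using hjudg_constant_sort C(1) by blast
    then have "\<exists>s\<^sub>4\<in>sorts X. \<Gamma> \<tturnstile> Prd A (Cst s) \<Colon> Cst s\<^sub>4"
      using hjudg_abstraction hjudg_product ex_rule application by meson
    moreover have "\<exists>s\<^sub>3\<in>sorts X. \<Gamma> \<tturnstile> Prd A C \<Colon> Cst s\<^sub>3"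
      using hjudg_abstraction hjudg_product ex_rule application C by meson
    ultimately show ?thesis
      using P C application hjudg_abstraction[OF C(1)] hjudg.application by blast
  qed
  have B: "A # \<Gamma> \<tturnstile> B \<Colon> Cst s\<^sub>2" using application by blast
  then obtain s where "s \<in> sorts X" "A # \<Gamma> \<tturnstile> Cst s\<^sub>2 \<Colon> Cst s" using hjudg_constant_sort by blast
  then have "\<Gamma> \<tturnstile> App (Abs A B) N \<Colon> Cst s\<^sub>2"
    using app[OF hjudg_abstraction[OF B]] by auto
  then have "\<Gamma> \<tturnstile> subst B N 0 \<Colon> Cst s\<^sub>2"
    by (blast intro: hjudg.subject_reduction beta.redex)
  then show ?case using app[OF _ B] application by blast
next
  case (abstraction A \<Gamma> M B s)
  then show ?case using hjudg_abstraction by blast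
next
  case (product A \<Gamma> B s\<^sub>2 s\<^sub>1 s\<^sub>3)
  then show ?case using hjudg_abstraction hjudg_product hjudg_constant_sort by blast
next
  case (conversion \<Gamma> M A B s)
  then show ?case by (blast intro: hjudg.conversion)
qed

end

theorem theorem27:
  fixes X :: "'c pts" and \<Gamma> :: "'c ctxt" and M A :: "'c trm"
  assumes "is_pts X" and "supersorted X"
  shows "derivable X \<Gamma> M A \<longleftrightarrow> derivable_hplus X \<Gamma> M A"
proof -
  interpret supersorted_pts X using assms by unfold_locales
  show ?thesis
    using derivable_iff_judg hplus_imp_judg judg_imp_hjudg hjudg_imp_hplus by blast
qed

end
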